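(* Let $H$ be a Hilbert space and $\Gamma=[-1,1]^\infty$. Let $\tau=(\tau_1,\tau_2,\ldots)$ be a sequence of positive numbers with $\tau_m\to\infty$ and assume that $v:\Gamma\to H$ admits a complex-analytic extension in the region $E(\tau):=\{z\in\mathbb{C}^\infty : \operatorname{dist}(z_m,[-1,1])<\tau_m\ \text{for all } m\}$, with $\|v\|_{L^\infty(\overline{E(\tau)};H)}<\infty$. Set $\rho_m:=\tau_m+\sqrt{1+\tau_m^2}$ and $\eta_m:=\sup_{n\ge m}\rho_n^{-1}$ for $m\in\mathbb{N}$, and let $\mathcal{A}_\varepsilon(\eta):=\{\alpha\in(\mathbb{N}_0^\infty)_c : \eta^\alpha\ge\varepsilon\}$ for $\varepsilon>0$. Assume that $\eta_m m^\sigma\to0$ as $m\to\infty$ for some $\sigma>2(1+\log4)$. Then for any $s<\sigma-2(1+\log4)$ there exists $C=C(v)>0$ such that $$\|v-\mathcal{I}_{\mathcal{A}_\varepsilon(\eta)}v\|_{L^2_\nu(\Gamma)\otimes H}\le C(v)\,N_{\mathcal{A}_\varepsilon(\eta)}^{-s/2}\qquad\text{as }\varepsilon\to0,$$ i.e. for all sufficiently small $\varepsilon>0$. Here $\mathcal{I}_{\mathcal{A}}$ is the sparse collocation operator and $N_{\mathcal{A}}$ the number of collocation points defined in the context.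
   Context: $\mathbb{N}=\{1,2,\ldots\}$, $\mathbb{N}_0=\mathbb{N}\cup\{0\}$, $\log$ is the natural logarithm, and $\nu$ is the uniform probability measure on $\Gamma$ (product of the measures $dy_m/2$). $L^2_\nu(\Gamma)\otimes H$ is the Bochner space $L^2(\Gamma,\nu;H)$. If $H$ is real, the extension takes values in its complexification. $\overline{E(\tau)}=\{z : \operatorname{dist}(z_m,[-1,1])\le\tau_m\ \forall m\}$ and $\|v\|_{L^\infty(\overline{E(\tau)};H)}$ is the supremum of $\|v(z)\|_H$ over $\overline{E(\tau)}$ of the extension (which is understood to be defined there). Complex-analytic means jointly analytic in the variables $z=(z_1,z_2,\ldots)$: continuous for the product topology and holomorphic in any finite number of variables with the others fixed. Multi-indices. $(\mathbb{N}_0^\infty)_c$ is the set of $\alpha\in\mathbb{N}_0^\infty$ whose support $\operatorname{supp}(\alpha)=\{m : \alpha_m\ne0\}$ is finite; $\eta^\alpha:=\prod_{m\in\operatorname{supp}\alpha}\eta_m^{\alpha_m}$ (with $0^0:=1$). A set $\mathcal{A}\subset(\mathbb{N}_0^\infty)_c$ is monotone if $\alpha\in\mathcal{A}$ and $\beta\le\alpha$ componentwise imply $\beta\in\mathcal{A}$; $\mathcal{A}_\varepsilon(\eta)$ is finite and monotone. Collocation operator. For $p\in\mathbb{N}_0$ let $\chi^{(p)}_0,\ldots,\chi^{(p)}_p$ be the zeros of the Legendre polynomial $L_{p+1}$ on $[-1,1]$, and let $\mathcal{I}^{(m)}_p$ be the operator, acting in the variable $y_m$, that maps a continuous function to the unique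 polynomial of degree at most $p$ interpolating it at these points; $\mathcal{I}^{(m)}_{-1}:=0$. For finite monotone $\mathcal{A}$, $$\mathcal{I}_{\mathcal{A}}:=\sum_{\alpha\in\mathcal{A}}\bigotimes_{m\in\operatorname{supp}\alpha}\bigl(\mathcal{I}^{(m)}_{\alpha_m}-\mathcal{I}^{(m)}_{\alpha_m-1}\bigr),$$ where in the variables $y_m$ with $m\notin\operatorname{supp}\alpha$ the operator $\mathcal{I}^{(m)}_0$, i.e. evaluation at $y_m=0$, is applied. Number of collocation points: $N_{\mathcal{A}}:=\sum_{\alpha\in\mathcal{A}}\prod_{m\in\operatorname{supp}\alpha}(\alpha_m+1)$. *)

theory Defs
  imports "HOL-Probability.Probability" "HOL-Computational_Algebra.Polynomial"
begin

text \<open>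
  Coordinates are indexed by \<^typ>\<open>nat\<close> starting at 0: the variable usually called $y_m$ with
  $m = 1, 2, \ldots$ is coordinate \<open>m - 1\<close> here.
\<close>

section \<open>Hilbert spaces\<close>

text \<open>
  A real Hilbert space is a type of class \<open>{real_inner, complete_space}\<close>. A complex Hilbert space
  is given by its underlying real Hilbert space together with the complex scalar multiplication
  and the Hermitian inner product inducing the norm.
\<close>

locale complex_hilbert = vector_space scaleC
  for scaleC :: "complex \<Rightarrow> 'k \<Rightarrow> 'k::{real_inner, complete_space}" +
  fixes cinner :: "'k \<Rightarrow> 'k \<Rightarrow> complex"
  assumes scaleC_of_real: "scaleC (of_real r) x = r *\<^sub>R x"
    and cinner_add_left: "cinner (x + y) z = cinner x z + cinner y z"
    and cinner_scaleC_left: "cinner (scaleC c x) y = c * cinner x y"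
    and cinner_commute: "cinner y x = cnj (cinner x y)"
    and cinner_self: "cinner x x = of_real ((norm x)\<^sup>2)"

text \<open>The complexification of \<open>'h\<close> is \<open>'h \<times> 'h\<close>, with \<open>(a, b)\<close> standing for $a + i b$.\<close>

definition complexification_scale ::
    "complex \<Rightarrow> 'h \<times> 'h \<Rightarrow> 'h \<times> 'h::real_vector" where
  "complexification_scale c x =
     (Re c *\<^sub>R fst x - Im c *\<^sub>R snd x, Re c *\<^sub>R snd x + Im c *\<^sub>R fst x)"

definition complexification_inner :: "'h \<times> 'h \<Rightarrow> 'h \<times> 'h::real_inner \<Rightarrow> complex" where
  "complexification_inner x y =
     Complex (fst x \<bullet> fst y + snd x \<bullet> snd y) (snd x \<bullet> fst y - fst x \<bullet> snd y)"

lemma complex_hilbert_complexification: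
  "complex_hilbert
     (complexification_scale :: complex \<Rightarrow> 'h \<times> 'h \<Rightarrow> 'h \<times> 'h::{real_inner, complete_space})
     complexification_inner"
  by unfold_locales
    (auto simp: complexification_scale_def complexification_inner_def complex_eq_iff
      prod_eq_iff algebra_simps inner_commute norm_prod_def power2_norm_eq_inner
      simp del: of_real_add)

section \<open>The parameter domain and its complex neighbourhood\<close>

definition Gam :: "(nat \<Rightarrow> real) set" where
  "Gam = {y. \<forall>m. y m \<in> {-1..1}}"

definition unif :: "(nat \<Rightarrow> real) measure" where
  "unif = PiM UNIV (\<lambda>_. density (restrict_space lborel {-1..1}) (\<lambda>_. 1 / 2))"

lemma space_unif: "space unif = Gam"
  by (auto simp: unif_def Gam_def space_PiM space_restrict_space PiE_def Pi_def)

definition region :: "(nat \<Rightarrow> real) \<Rightarrow> (nat \<Rightarrow> complex) set" where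
  "region \<tau> = {z. \<forall>m. infdist (z m) (of_real ` {-1..1}) < \<tau> m}"

definition closed_region :: "(nat \<Rightarrow> real) \<Rightarrow> (nat \<Rightarrow> complex) set" where
  "closed_region \<tau> = {z. \<forall>m. infdist (z m) (of_real ` {-1..1}) \<le> \<tau> m}"

text \<open>
  Complex Frechet differentiability in each finite set \<open>S\<close> of variables, the other variables being
  fixed; \<open>d m\<close> is the partial derivative in direction \<open>m\<close>. Intended for \<open>U\<close> such as
  \<^term>\<open>region \<tau>\<close>, whose slices along finitely many coordinates are open, so that
  all sufficiently small increments \<open>h\<close> supported in \<open>S\<close> stay in \<open>U\<close>.
\<close>

definition finitely_holomorphic_on ::
    "(complex \<Rightarrow> 'k \<Rightarrow> 'k) \<Rightarrow> ((nat \<Rightarrow> complex) \<Rightarrow> 'k::real_normed_vector) \<Rightarrow>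
     (nat \<Rightarrow> complex) set \<Rightarrow> bool" where
  "finitely_holomorphic_on scaleC u U \<longleftrightarrow>
     (\<forall>z\<in>U. \<forall>S. finite S \<longrightarrow> (\<exists>d. \<forall>e>0. \<exists>\<delta>>0. \<forall>h.
        (\<forall>m. m \<notin> S \<longrightarrow> h m = 0) \<and> (\<forall>m\<in>S. norm (h m) < \<delta>) \<longrightarrow>
        norm (u (\<lambda>m. z m + h m) - u z - (\<Sum>m\<in>S. scaleC (h m) (d m)))
          \<le> e * (\<Sum>m\<in>S. norm (h m))))"

text \<open>
  The map \<open>\<iota>\<close> embeds the space of values of \<open>v\<close> into the complex space in which the
  extension \<open>u\<close> takes its values. Continuity refers to the product topology on
  \<^typ>\<open>nat \<Rightarrow> complex\<close>.
\<close>

definition analytic_extension ::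
    "(complex \<Rightarrow> 'k \<Rightarrow> 'k) \<Rightarrow> ('h \<Rightarrow> 'k) \<Rightarrow> (nat \<Rightarrow> real) \<Rightarrow>
     ((nat \<Rightarrow> real) \<Rightarrow> 'h) \<Rightarrow> ((nat \<Rightarrow> complex) \<Rightarrow> 'k::real_normed_vector) \<Rightarrow> bool" where
  "analytic_extension scaleC \<iota> \<tau> v u \<longleftrightarrow>
     continuous_on (region \<tau>) u \<and>
     finitely_holomorphic_on scaleC u (region \<tau>) \<and>
     (\<forall>y\<in>Gam. u (\<lambda>m. of_real (y m)) = \<iota> (v y))"

definition sup_norm ::
    "(nat \<Rightarrow> complex) set \<Rightarrow> ((nat \<Rightarrow> complex) \<Rightarrow> 'k::real_normed_vector) \<Rightarrow> ennreal" where
  "sup_norm U u = (SUP z\<in>U. ennreal (norm (u z)))"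

definition rho :: "(nat \<Rightarrow> real) \<Rightarrow> nat \<Rightarrow> real" where
  "rho \<tau> m = \<tau> m + sqrt (1 + (\<tau> m)\<^sup>2)"

definition eta :: "(nat \<Rightarrow> real) \<Rightarrow> nat \<Rightarrow> real" where
  "eta \<tau> m = (SUP n\<in>{m..}. inverse (rho \<tau> n))"

section \<open>Multi-indices\<close>

definition supp :: "(nat \<Rightarrow> nat) \<Rightarrow> nat set" where
  "supp \<alpha> = {m. \<alpha> m \<noteq> 0}"

definition multi_power :: "(nat \<Rightarrow> real) \<Rightarrow> (nat \<Rightarrow> nat) \<Rightarrow> real" where
  "multi_power \<eta> \<alpha> = (\<Prod>m\<in>supp \<alpha>. \<eta> m ^ \<alpha> m)"

definition index_set :: "(nat \<Rightarrow> real) \<Rightarrow> real \<Rightarrow> (nat \<Rightarrow> nat) set" where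
  "index_set \<eta> \<epsilon> = {\<alpha>. finite (supp \<alpha>) \<and> multi_power \<eta> \<alpha> \<ge> \<epsilon>}"

section \<open>Sparse collocation\<close>

text \<open>Rodrigues' formula.\<close>

definition legendre :: "nat \<Rightarrow> real poly" where
  "legendre n = smult (1 / (2 ^ n * fact n)) ((pderiv ^^ n) ([:-1, 0, 1:] ^ n))"

definition nodes :: "nat \<Rightarrow> real set" where
  "nodes p = {x \<in> {-1..1}. poly (legendre (p + 1)) x = 0}"

definition interp :: "nat \<Rightarrow> (real \<Rightarrow> 'h) \<Rightarrow> real \<Rightarrow> 'h::real_vector" where
  "interp p f = (THE g. (\<exists>a. g = (\<lambda>t. \<Sum>k\<le>p. t ^ k *\<^sub>R a k)) \<and> (\<forall>x\<in>nodes p. g x = f x))"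

definition interp_diff :: "nat \<Rightarrow> (real \<Rightarrow> 'h) \<Rightarrow> real \<Rightarrow> 'h::real_vector" where
  "interp_diff p f t = interp p f t - (if p = 0 then 0 else interp (p - 1) f t)"

definition in_variable ::
    "nat \<Rightarrow> ((real \<Rightarrow> 'h) \<Rightarrow> real \<Rightarrow> 'h) \<Rightarrow>
     ((nat \<Rightarrow> real) \<Rightarrow> 'h) \<Rightarrow> (nat \<Rightarrow> real) \<Rightarrow> 'h" where
  "in_variable m T g y = T (\<lambda>t. g (y(m := t))) (y m)"

text \<open>
  The tensor product of operators acting in distinct variables is their composition; the order is
  immaterial, and the increasing order of the variables is used. The innermost function is \<open>v\<close>
  with all variables outside the support set to 0.
\<close>

definition tensor_diff ::
    "(nat \<Rightarrow> nat) \<Rightarrow> ((nat \<Rightarrow> real) \<Rightarrow> 'h) \<Rightarrow> (nat \<Rightarrow> real) \<Rightarrow> 'h::real_vector" where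
  "tensor_diff \<alpha> v =
     foldr (\<lambda>m. in_variable m (interp_diff (\<alpha> m))) (sorted_list_of_set (supp \<alpha>))
       (\<lambda>y. v (\<lambda>m. if m \<in> supp \<alpha> then y m else 0))"

definition collocation ::
    "(nat \<Rightarrow> nat) set \<Rightarrow> ((nat \<Rightarrow> real) \<Rightarrow> 'h) \<Rightarrow> (nat \<Rightarrow> real) \<Rightarrow> 'h::real_vector" where
  "collocation A v y = (\<Sum>\<alpha>\<in>A. tensor_diff \<alpha> v y)"

definition num_points :: "(nat \<Rightarrow> nat) set \<Rightarrow> nat" where
  "num_points A = (\<Sum>\<alpha>\<in>A. \<Prod>m\<in>supp \<alpha>. (\<alpha> m + 1))"

section \<open>Bochner $L^2$ space\<close>

text \<open>
  The first two conditions express strong measurability (measurable and almost everywhere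
  separably valued), which plain Borel measurability does not give for non-separable \<open>'h\<close>.
\<close>

definition bochner_L2 :: "'a measure \<Rightarrow> ('a \<Rightarrow> 'h::real_normed_vector) set" where
  "bochner_L2 M =
     {f. f \<in> borel_measurable M \<and>
         (\<exists>S. countable S \<and> (AE x in M. f x \<in> closure S)) \<and>
         integrable M (\<lambda>x. (norm (f x))\<^sup>2)}"

definition L2_norm :: "'a measure \<Rightarrow> ('a \<Rightarrow> 'h::real_normed_vector) \<Rightarrow> real" where
  "L2_norm M f = sqrt (\<integral>x. (norm (f x))\<^sup>2 \<partial>M)"

end

theory Submission
  imports Defs "HOL-Complex_Analysis.Complex_Analysis" "HOL-Real_Asymp.Real_Asymp"
begin

text \<open>
  The whole argument runs in the supremum norm. Gauss--Legendre interpolation has a Lebesgue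
  constant of order $p^2$: quadrature is exact in degree $2p+1$ with positive weights, so a
  polynomial bounded by 1 at the nodes is bounded in $L^2$, hence (Nikolskii) uniformly. Chebyshev
  approximation of a function holomorphic near the ellipse with semi-axis sum $\rho_m$ then gives a
  bound of order $p^2 \rho_m^{-p}$ for the difference operator of level $p \ge 1$ in the variable
  $y_m$. Iterating over the variables, the term with index $\alpha$ is at most
  $M w(\alpha) \eta^\alpha$, where $w(\alpha) = \prod_{m \in \mathrm{supp}\,\alpha} K (\alpha_m+1)^2$
  also dominates the number of points contributed by $\alpha$.

  If $\sum_m \eta_m^q < \infty$, that is $q \sigma > 1$, then
  $S = \sum_\alpha w(\alpha) (\eta^\alpha)^q$ is finite. The error is at most
  $M \sum_{\eta^\alpha < \varepsilon} w(\alpha) \eta^\alpha \le M S \varepsilon^{1-q}$ and the number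
  of points at most $S \varepsilon^{-q}$, so $q = 1 / (1 + \max(s, 0) / 2)$ yields the rate.
  Hilbert space values are reduced to complex ones by pairing with a fixed vector, which commutes
  with the collocation operator.
\<close>

section \<open>Gauss--Legendre nodes\<close>

text \<open>Two obstacles shape the proof. The constants of the one-variable estimates multiply over
  the variables. Level 0 is evaluation at 0 and costs exactly 1, while every level p >= 1 in
  variable m carries a factor \<eta>_m: after raising to the power q, the sum over all levels is at
  most 1 + D \<eta>_m^q, and the product over m is at most the exponential of D times the sum of the
  \<eta>_m^q. The second obstacle is the infinite number of variables: estimates are proved for
  functions of the first n coordinates, with bounds free of n, and continuity in the product
  topology lets n tend to infinity. Interpolation is a finite linear combination of point
  evaluations; hence an operator in one variable preserves holomorphy in the others, commutes with
  linear maps and can be applied term by term to an infinite sum. The choice of q balances the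
  exponents: with r = max(s, 0) it gives 1 - q = q r / 2, so \<epsilon>^(1-q) =
  (\<epsilon>^(-q))^(-r/2).\<close>

lemma Rolle_poly_card:
  fixes p :: "real poly"
  assumes "finite S" "S \<noteq> {}" "\<And>x. x \<in> S \<Longrightarrow> poly p x = 0"
  shows "\<exists>T. finite T \<and> card T = card S - 1 \<and> T \<subseteq> {Min S<..<Max S} \<and> (\<forall>x\<in>T. poly (pderiv p) x = 0)"
  using assms
proof (induction S rule: finite_linorder_max_induct)
  case empty
  then show ?case by simp
next
  case (insert b A)
  show ?case
  proof (cases "A = {}")
    case True
    then show ?thesis by (intro exI[of _ "{}"]) auto
  next
    case False
    with insert obtain T where T: "finite T" "card T = card A - 1" "T \<subseteq> {Min A<..<Max A}"
      "\<forall>x\<in>T. poly (pderiv p) x = 0"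
      by auto
    have MA: "Max A \<in> A" "Min A \<in> A" using insert False by auto
    then have "Max A < b" "poly p (Max A) = 0" "poly p b = 0" using insert by auto
    then obtain c where c: "Max A < c" "c < b" "poly (pderiv p) c = 0"
      using poly_MVT[of "Max A" b p] by auto
    have "c \<notin> T" using T c by auto
    moreover have "Max (insert b A) = b" "Min (insert b A) = Min A" "card A > 0" "b \<notin> A"
      using insert MA False \<open>Max A < b\<close> by (auto simp: card_gt_0_iff intro: Max_eqI Min_eqI)
    moreover have "Min A \<le> Max A" using MA insert by (simp add: Max.coboundedI)
    ultimately have "finite (insert c T)" "card (insert c T) = card (insert b A) - 1"
        "insert c T \<subseteq> {Min (insert b A)<..<Max (insert b A)}"
        "\<forall>x\<in>insert c T. poly (pderiv p) x = 0"
      using T c insert.hyps(1) by auto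
    then show ?thesis by blast
  qed
qed

text \<open>Up to a factor, \<open>rodrigues n n\<close> is the Legendre polynomial. The lower
  derivatives are kept as objects of their own because both the count of zeros and the orthogonality
  run by induction on the order \<open>k\<close> of differentiation.\<close>

definition rodrigues :: "nat \<Rightarrow> nat \<Rightarrow> real poly" where
  "rodrigues n k = (pderiv ^^ k) ([:-1, 0, 1:] ^ n)"

lemma rodrigues_Suc: "rodrigues n (Suc k) = pderiv (rodrigues n k)"
  by (simp add: rodrigues_def)

lemma power_dvd_pderiv:
  fixes a p :: "'a::idom poly"
  assumes "a ^ Suc m dvd p"
  shows "a ^ m dvd pderiv p"
proof -
  obtain h where "p = a ^ Suc m * h" using assms by auto
  then have "pderiv p = a ^ Suc m * pderiv h + h * (smult (of_nat (Suc m)) (a ^ m) * pderiv a)"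
    by (simp only: pderiv_mult pderiv_power_Suc)
  also have "\<dots> = a ^ m * (a * pderiv h + h * smult (of_nat (Suc m)) (pderiv a))"
    by (simp add: distrib_left ac_simps)
  finally show ?thesis by simp
qed

text \<open>Each differentiation costs at most one power of x^2 - 1. Whatever survives forces zeros
  at both endpoints, which feeds Rolle's theorem and kills the boundary terms of integration by
  parts.\<close>

lemma rodrigues_dvd: "k \<le> n \<Longrightarrow> [:-1, 0, 1:] ^ (n - k) dvd rodrigues n k"
proof (induction k)
  case 0
  then show ?case by (simp add: rodrigues_def)
next
  case (Suc k)
  then show ?case
    using power_dvd_pderiv[of "[:-1, 0, 1:]" "n - Suc k" "rodrigues n k"]
    by (simp add: rodrigues_Suc Suc_diff_Suc)
qed

lemma rodrigues_endpoints:
  assumes "k < n" "x\<^sup>2 = 1"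
  shows "poly (rodrigues n k) x = 0"
proof -
  obtain h where "rodrigues n k = [:-1, 0, 1:] ^ (n - k) * h"
    using rodrigues_dvd[of k n] assms by auto
  then show ?thesis using assms by (simp add: power2_eq_square)
qed

lemma degree_rodrigues: "k \<le> n \<Longrightarrow> degree (rodrigues n k) = 2 * n - k"
  by (induction k) (auto simp: rodrigues_Suc degree_pderiv, simp add: rodrigues_def degree_power_eq)

text \<open>Rolle's theorem, order by order: for k < n the endpoints -1 and 1 are zeros besides the
  k interior ones, and k + 2 zeros leave k + 1 interior zeros of the derivative.\<close>

lemma rodrigues_zeros:
  "k \<le> n \<Longrightarrow> \<exists>T. finite T \<and> card T = k \<and> T \<subseteq> {-1<..<1} \<and> (\<forall>x\<in>T. poly (rodrigues n k) x = 0)"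
proof (induction k)
  case 0
  then show ?case by auto
next
  case (Suc k)
  then obtain T where T: "finite T" "card T = k" "T \<subseteq> {-1<..<1}"
      "\<forall>x\<in>T. poly (rodrigues n k) x = 0" by auto
  let ?S = "insert (-1) (insert 1 T)"
  have "Min ?S = -1" by (rule Min_eqI) (use T in auto)
  moreover have "Max ?S = 1" by (rule Max_eqI) (use T in auto)
  moreover have "1 \<notin> T" "-1 \<notin> T" using T by auto
  then have "card ?S = k + 2" using T by simp
  moreover have "poly (rodrigues n k) x = 0" if "x \<in> ?S" for x
    using that T rodrigues_endpoints[of k n x] Suc by auto
  ultimately show ?case
    using Rolle_poly_card[of ?S "rodrigues n k"] T by (auto simp: rodrigues_Suc)
qed

lemma legendre_rodrigues: "legendre n = smult (1 / (2 ^ n * fact n)) (rodrigues n n)"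
  by (simp add: legendre_def rodrigues_def)

lemma degree_legendre: "degree (legendre n) = n"
  by (simp add: legendre_rodrigues degree_rodrigues)

lemma legendre_nonzero: "legendre n \<noteq> 0"
proof (cases n)
  case 0
  then show ?thesis by (simp add: legendre_def)
next
  case (Suc m)
  then show ?thesis using degree_legendre[of n] by fastforce
qed

lemma finite_nodes: "finite (nodes p)"
  unfolding nodes_def using poly_roots_finite[OF legendre_nonzero[of "p + 1"]]
  by (rule rev_finite_subset) auto

lemma nodes_subset: "nodes p \<subseteq> {-1..1}"
  by (auto simp: nodes_def)

lemma card_nodes: "card (nodes p) = p + 1"
proof (rule antisym)
  have "card (nodes p) \<le> card {x. poly (legendre (p + 1)) x = 0}"
    using poly_roots_finite[OF legendre_nonzero[of "p + 1"]] by (intro card_mono) (auto simp: nodes_def)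
  also have "\<dots> \<le> p + 1"
    using card_poly_roots_bound[OF legendre_nonzero[of "p + 1"]] by (simp add: degree_legendre)
  finally show "card (nodes p) \<le> p + 1" .
  obtain T where T: "finite T" "card T = p + 1" "T \<subseteq> {-1<..<1}" "\<forall>x\<in>T. poly (rodrigues (p+1) (p+1)) x = 0"
    using rodrigues_zeros[of "p+1" "p+1"] by auto
  then have "T \<subseteq> nodes p" by (force simp: nodes_def legendre_rodrigues)
  then show "p + 1 \<le> card (nodes p)" using card_mono[OF finite_nodes] T by metis
qed

lemma nodes_0: "nodes 0 = {0}"
  by (auto simp: nodes_def legendre_def pderiv_pCons)

section \<open>Lagrange interpolation\<close>

definition lag :: "nat \<Rightarrow> real \<Rightarrow> real poly" where
  "lag p x = smult (1 / (\<Prod>y\<in>nodes p - {x}. x - y)) (\<Prod>y\<in>nodes p - {x}. [:- y, 1:])"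

lemma degree_lag: "x \<in> nodes p \<Longrightarrow> degree (lag p x) \<le> p"
proof -
  assume x: "x \<in> nodes p"
  have "degree (\<Prod>y\<in>nodes p - {x}. [:- y, 1:]) \<le> (\<Sum>y\<in>nodes p - {x}. degree [:- y, 1:])"
    by (rule degree_prod_sum_le[unfolded o_def]) (simp add: finite_nodes)
  also have "\<dots> = p" using x by (simp add: card_nodes)
  finally show ?thesis unfolding lag_def by (meson degree_smult_le le_trans)
qed

lemma poly_lag:
  assumes "x \<in> nodes p" "y \<in> nodes p"
  shows "poly (lag p x) y = (if x = y then 1 else 0)"
  using assms finite_nodes[of p] by (auto simp: lag_def poly_prod)

lemma lagrange_reproduces:
  assumes "degree q \<le> p"
  shows "(\<Sum>x\<in>nodes p. smult (poly q x) (lag p x)) = q"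
proof (rule poly_eqI_degree[of "nodes p"])
  have "degree (\<Sum>x\<in>nodes p. smult (poly q x) (lag p x)) \<le> p"
    using degree_lag by (intro degree_sum_le finite_nodes) (auto intro: order.trans[OF degree_smult_le])
  then show "card (nodes p) > degree (\<Sum>x\<in>nodes p. smult (poly q x) (lag p x))"
    by (simp add: card_nodes)
  show "card (nodes p) > degree q" using assms by (simp add: card_nodes)
  show "poly (\<Sum>x\<in>nodes p. smult (poly q x) (lag p x)) y = poly q y" if "y \<in> nodes p" for y
    using that by (simp add: poly_sum poly_lag finite_nodes if_distrib cong: if_cong sum.cong)
qed

lemma lagrange_reproduces_poly:
  assumes "degree q \<le> p"
  shows "(\<Sum>x\<in>nodes p. poly (lag p x) t * poly q x) = poly q t"
  by (subst (2) lagrange_reproduces[OF assms, symmetric]) (simp add: poly_sum mult.commute)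

lemma poly_altdef_le:
  assumes "degree q \<le> p"
  shows "poly q (t::'a::comm_semiring_1) = (\<Sum>k\<le>p. coeff q k * t ^ k)"
  unfolding poly_altdef using assms
  by (intro sum.mono_neutral_left) (auto simp: coeff_eq_0)

text \<open>Resolves the definite description in \<open>interp\<close>. Polynomials with vector
  coefficients are plain functions here, so uniqueness comes from the scalar reproduction property
  applied to every monomial t^k.\<close>

lemma interp_eq: "interp p f t = (\<Sum>x\<in>nodes p. poly (lag p x) t *\<^sub>R f x)"
proof -
  let ?g = "\<lambda>t. \<Sum>x\<in>nodes p. poly (lag p x) t *\<^sub>R f x"
  have "interp p f = ?g"
    unfolding interp_def
  proof (rule the_equality, intro conjI exI[of _ "\<lambda>k. \<Sum>x\<in>nodes p. coeff (lag p x) k *\<^sub>R f x"] ballI ext)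
    fix t
    have "?g t = (\<Sum>x\<in>nodes p. \<Sum>k\<le>p. t ^ k *\<^sub>R coeff (lag p x) k *\<^sub>R f x)"
      using degree_lag by (intro sum.cong refl) (simp add: poly_altdef_le[of _ p] scaleR_left.sum mult.commute)
    also have "\<dots> = (\<Sum>k\<le>p. t ^ k *\<^sub>R (\<Sum>x\<in>nodes p. coeff (lag p x) k *\<^sub>R f x))"
      by (subst sum.swap) (simp add: scaleR_sum_right)
    finally show "?g t = \<dots>" .
    show "?g x = f x" if "x \<in> nodes p" for x
      using that by (simp add: poly_lag finite_nodes if_distrib[of "\<lambda>c. c *\<^sub>R _"] cong: if_cong sum.cong)
  next
    fix g :: "real \<Rightarrow> 'a"
    assume g: "(\<exists>a. g = (\<lambda>t. \<Sum>k\<le>p. t ^ k *\<^sub>R a k)) \<and> (\<forall>x\<in>nodes p. g x = f x)"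
    then obtain a where a: "g = (\<lambda>t. \<Sum>k\<le>p. t ^ k *\<^sub>R a k)" by auto
    show "g = ?g"
    proof
      fix t
      have "?g t = (\<Sum>x\<in>nodes p. poly (lag p x) t *\<^sub>R g x)" using g by simp
      also have "\<dots> = (\<Sum>k\<le>p. (\<Sum>x\<in>nodes p. poly (lag p x) t * poly (monom 1 k) x) *\<^sub>R a k)"
        unfolding a scaleR_sum_right scaleR_left.sum
        by (subst sum.swap) (simp add: poly_monom)
      also have "\<dots> = g t"
        unfolding a
      proof (rule sum.cong[OF refl])
        fix k assume "k \<in> {..p}"
        then have "degree (monom (1::real) k) \<le> p" by (simp add: degree_monom_eq)
        from lagrange_reproduces_poly[OF this, of t]
        show "(\<Sum>x\<in>nodes p. poly (lag p x) t * poly (monom 1 k) x) *\<^sub>R a k = t ^ k *\<^sub>R a k"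
          by (simp add: poly_monom)
      qed
      finally show "g t = ?g t" by simp
    qed
  qed
  then show ?thesis by simp
qed

section \<open>Gauss quadrature and the Lebesgue constant\<close>

text \<open>The integral of q over [-1,1] after the substitution x = cos \<theta>. The sine factor
  of the substitution is what later turns q into a finite sine series.\<close>

definition quad :: "real poly \<Rightarrow> real" where
  "quad q = integral {0..pi} (\<lambda>\<theta>. poly q (cos \<theta>) * sin \<theta>)"

lemma quad_integrable: "(\<lambda>\<theta>. poly q (cos \<theta>) * sin \<theta>) integrable_on {0..pi}"
  by (intro integrable_continuous_real continuous_intros)

lemma quad_add: "quad (p + q) = quad p + quad q"
  unfolding quad_def by (simp add: distrib_right integral_add[OF quad_integrable quad_integrable])

lemma quad_smult: "quad (smult c q) = c * quad q"
  unfolding quad_def by (simp add: mult.assoc)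

lemma quad_0: "quad 0 = 0"
  by (simp add: quad_def)

lemma quad_sum: "quad (\<Sum>x\<in>A. f x) = (\<Sum>x\<in>A. quad (f x))"
  by (induction A rule: infinite_finite_induct) (auto simp: quad_add quad_0)

lemma quad_nonneg: "(\<And>x. poly q x \<ge> 0) \<Longrightarrow> quad q \<ge> 0"
  unfolding quad_def by (intro integral_nonneg quad_integrable mult_nonneg_nonneg sin_ge_zero) auto

lemma quad_pderiv: "quad (pderiv q) = poly q 1 - poly q (-1)"
proof -
  have "((\<lambda>\<theta>. poly (pderiv q) (cos \<theta>) * sin \<theta>) has_integral
      (- poly q (cos pi) - (- poly q (cos 0)))) {0..pi}"
  proof (rule fundamental_theorem_of_calculus)
    fix x :: real
    have "((\<lambda>\<theta>. - poly q (cos \<theta>)) has_real_derivative poly (pderiv q) (cos x) * sin x) (at x within {0..pi})"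
      by (auto intro!: derivative_eq_intros)
    then show "((\<lambda>\<theta>. - poly q (cos \<theta>)) has_vector_derivative poly (pderiv q) (cos x) * sin x) (at x within {0..pi})"
      by (simp add: has_real_derivative_iff_has_vector_derivative)
  qed simp
  then show ?thesis unfolding quad_def by (simp add: integral_unique)
qed

text \<open>Integration by parts moves one derivative at a time onto q until nothing is left; the
  boundary terms vanish by \<open>rodrigues_endpoints\<close>. The disjunct \<open>q = 0\<close>
  closes the induction: the zero polynomial has degree 0, which is not below k = 0.\<close>

lemma quad_rodrigues:
  "k \<le> n \<Longrightarrow> degree q < k \<or> q = 0 \<Longrightarrow> quad (rodrigues n k * q) = 0"
proof (induction k arbitrary: q)
  case 0
  then show ?case by (simp add: quad_0)
next
  case (Suc k)
  have "degree (pderiv q) < k \<or> pderiv q = 0"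
    using Suc.prems by (cases "degree q = 0") (auto simp: degree_pderiv pderiv_eq_0_iff)
  then have "quad (rodrigues n k * pderiv q) = 0" using Suc by simp
  moreover have "quad (pderiv (rodrigues n k * q)) = 0"
    using Suc.prems by (simp add: quad_pderiv rodrigues_endpoints)
  ultimately show ?case
    by (simp add: pderiv_mult quad_add rodrigues_Suc mult.commute)
qed

text \<open>Division with remainder by the Legendre polynomial: the quotient has degree at most p
  and is orthogonal to it; the remainder has degree at most p, agrees with q at the nodes and is
  integrated exactly through its Lagrange form.\<close>

lemma gauss_quadrature:
  assumes "degree q \<le> 2 * p + 1"
  shows "quad q = (\<Sum>x\<in>nodes p. poly q x * quad (lag p x))"
proof -
  let ?L = "legendre (p + 1)"
  define h where "h = q div ?L"
  define r where "r = q mod ?L"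
  have q: "q = ?L * h + r" by (simp add: h_def r_def)
  have r: "degree r \<le> p"
    using degree_mod_less'[of ?L q] legendre_nonzero[of "p + 1"]
    by (cases "r = 0") (auto simp: r_def degree_legendre)
  have "degree h < p + 1"
  proof (cases "h = 0")
    case False
    then have "degree (?L * h) = p + 1 + degree h"
      by (simp add: degree_mult_eq legendre_nonzero degree_legendre)
    then have "degree q = p + 1 + degree h" using r unfolding q by (simp add: degree_add_eq_left)
    then show ?thesis using assms by simp
  qed simp
  then have "quad (?L * h) = 0"
    by (simp add: legendre_rodrigues quad_smult quad_rodrigues)
  then have "quad q = quad r" unfolding q by (simp add: quad_add)
  also have "quad r = quad (\<Sum>x\<in>nodes p. smult (poly r x) (lag p x))"
    by (simp only: lagrange_reproduces[OF r])
  also have "\<dots> = (\<Sum>x\<in>nodes p. poly r x * quad (lag p x))"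
    by (simp add: quad_sum quad_smult)
  also have "\<dots> = (\<Sum>x\<in>nodes p. poly q x * quad (lag p x))"
    by (intro sum.cong) (auto simp: q nodes_def)
  finally show ?thesis .
qed

text \<open>Quadrature applied to the square of the basis polynomial, of degree at most 2p, returns
  the weight itself, since that square is again 1 at x and 0 at the other nodes.\<close>

lemma quad_lag_nonneg:
  assumes "x \<in> nodes p"
  shows "quad (lag p x) \<ge> 0"
proof -
  have "degree (lag p x * lag p x) \<le> 2 * p + 1"
    using degree_lag[OF assms] degree_mult_le[of "lag p x" "lag p x"] by simp
  from gauss_quadrature[OF this] have "quad (lag p x * lag p x) = quad (lag p x)"
    using assms by (simp add: poly_lag finite_nodes if_distrib[of "\<lambda>c. c * _"] cong: if_cong sum.cong)
  moreover have "quad (lag p x * lag p x) \<ge> 0" by (rule quad_nonneg) simp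
  ultimately show ?thesis by simp
qed

lemma quad_1: "quad 1 = 2"
  using quad_pderiv[of "[:0, 1:]"] by (simp add: pderiv_pCons one_pCons)

section \<open>Sine series and a uniform bound for polynomials\<close>

lemma has_integral_cos_nat:
  assumes "n > 0"
  shows "((\<lambda>\<theta>. cos (real n * \<theta>)) has_integral 0) {0..pi}"
proof -
  have "((\<lambda>\<theta>. cos (real n * \<theta>)) has_integral (sin (real n * pi) / real n - sin (real n * 0) / real n)) {0..pi}"
  proof (rule fundamental_theorem_of_calculus)
    fix x :: real
    have "((\<lambda>\<theta>. sin (real n * \<theta>) / n) has_real_derivative cos (real n * x)) (at x within {0..pi})"
      using assms by (auto intro!: derivative_eq_intros)
    then show "((\<lambda>\<theta>. sin (real n * \<theta>) / n) has_vector_derivative cos (real n * x)) (at x within {0..pi})"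
      by (simp add: has_real_derivative_iff_has_vector_derivative)
  qed simp
  then show ?thesis by simp
qed

lemma has_integral_sin_sin:
  "((\<lambda>\<theta>. sin (real (Suc j) * \<theta>) * sin (real (Suc k) * \<theta>)) has_integral (if j = k then pi / 2 else 0)) {0..pi}"
proof -
  have eq: "sin (real (Suc j) * \<theta>) * sin (real (Suc k) * \<theta>) =
      (cos (real (nat \<bar>int j - int k\<bar>) * \<theta>) - cos (real (j + k + 2) * \<theta>)) / 2" for \<theta>
  proof -
    have "real (nat \<bar>int j - int k\<bar>) * \<theta> = \<bar>real j - real k\<bar> * \<theta>" by simp
    then have "cos (real (nat \<bar>int j - int k\<bar>) * \<theta>) = cos (real (Suc j) * \<theta> - real (Suc k) * \<theta>)"
      by (cases "j \<ge> k") (auto simp: algebra_simps cos_diff)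
    then show ?thesis
      by (simp add: sin_times_sin algebra_simps)
  qed
  have 0: "((\<lambda>\<theta>. cos (real (j + k + 2) * \<theta>)) has_integral 0) {0..pi}"
    by (rule has_integral_cos_nat) simp
  show ?thesis
  proof (cases "j = k")
    case True
    have "((\<lambda>\<theta>. (1 - cos (real (j + k + 2) * \<theta>)) / 2) has_integral (pi - 0) / 2) {0..pi}"
      using has_integral_const_real[of "1::real" 0 pi]
      by (intro has_integral_divide has_integral_diff 0) simp
    then show ?thesis using True unfolding eq by simp
  next
    case False
    have "((\<lambda>\<theta>. (cos (real (nat \<bar>int j - int k\<bar>) * \<theta>) - cos (real (j + k + 2) * \<theta>)) / 2) has_integral (0 - 0) / 2) {0..pi}"
      using False by (intro has_integral_divide has_integral_diff 0 has_integral_cos_nat) simp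
    then show ?thesis using False unfolding eq by simp
  qed
qed

text \<open>The index k stands for frequency k + 1. The frequencies 1, ..., n + 1 are those of sin
  \<theta> times a polynomial of degree n in cos \<theta>, as for the Chebyshev polynomials of the
  second kind.\<close>

definition sine_poly :: "nat \<Rightarrow> (real \<Rightarrow> real) \<Rightarrow> bool" where
  "sine_poly n f \<longleftrightarrow> (\<exists>b. \<forall>\<theta>. f \<theta> = (\<Sum>k\<le>n. b k * sin (real (Suc k) * \<theta>)))"

lemma sine_poly_sin:
  assumes "j \<le> n"
  shows "sine_poly n (\<lambda>\<theta>. sin (real (Suc j) * \<theta>))"
  unfolding sine_poly_def
  by (rule exI[of _ "\<lambda>k. if k = j then 1 else 0"])
     (use assms in \<open>simp add: if_distrib[of "\<lambda>c. c * _"] cong: if_cong\<close>)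

lemma sine_poly_add: "sine_poly n f \<Longrightarrow> sine_poly n g \<Longrightarrow> sine_poly n (\<lambda>\<theta>. f \<theta> + g \<theta>)"
  unfolding sine_poly_def
proof (elim exE)
  fix a b
  assume "\<forall>\<theta>. f \<theta> = (\<Sum>k\<le>n. a k * sin (real (Suc k) * \<theta>))"
    "\<forall>\<theta>. g \<theta> = (\<Sum>k\<le>n. b k * sin (real (Suc k) * \<theta>))"
  then show "\<exists>b. \<forall>\<theta>. f \<theta> + g \<theta> = (\<Sum>k\<le>n. b k * sin (real (Suc k) * \<theta>))"
    by (intro exI[of _ "\<lambda>k. a k + b k"]) (simp add: distrib_right sum.distrib)
qed

lemma sine_poly_cmult: "sine_poly n f \<Longrightarrow> sine_poly n (\<lambda>\<theta>. c * f \<theta>)"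
  unfolding sine_poly_def
proof (elim exE)
  fix a
  assume "\<forall>\<theta>. f \<theta> = (\<Sum>k\<le>n. a k * sin (real (Suc k) * \<theta>))"
  then show "\<exists>b. \<forall>\<theta>. c * f \<theta> = (\<Sum>k\<le>n. b k * sin (real (Suc k) * \<theta>))"
    by (intro exI[of _ "\<lambda>k. c * a k"]) (simp add: mult.assoc sum_distrib_left)
qed

lemma sine_poly_zero: "sine_poly n (\<lambda>\<theta>. 0)"
  unfolding sine_poly_def by (rule exI[of _ "\<lambda>_. 0"]) simp

lemma sine_poly_sum: "(\<And>i. i \<in> A \<Longrightarrow> sine_poly n (f i)) \<Longrightarrow> sine_poly n (\<lambda>\<theta>. \<Sum>i\<in>A. f i \<theta>)"
  by (induction A rule: infinite_finite_induct) (auto intro: sine_poly_add sine_poly_zero)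

lemma sine_poly_cos:
  assumes "sine_poly n f"
  shows "sine_poly (Suc n) (\<lambda>\<theta>. cos \<theta> * f \<theta>)"
proof -
  obtain b where b: "\<And>\<theta>. f \<theta> = (\<Sum>k\<le>n. b k * sin (real (Suc k) * \<theta>))"
    using assms by (auto simp: sine_poly_def)
  have "(\<lambda>\<theta>. cos \<theta> * f \<theta>) = (\<lambda>\<theta>. \<Sum>k\<le>n. b k * (cos \<theta> * sin (real (Suc k) * \<theta>)))"
    by (simp add: b sum_distrib_left mult_ac fun_eq_iff)
  moreover have "sine_poly (Suc n) (\<lambda>\<theta>. \<Sum>k\<le>n. b k * (cos \<theta> * sin (real (Suc k) * \<theta>)))"
  proof (intro sine_poly_sum sine_poly_cmult)
    fix k assume k: "k \<in> {..n}"
    have eq: "(\<lambda>\<theta>. cos \<theta> * sin (real (Suc k) * \<theta>)) =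
       (\<lambda>\<theta>. 1/2 * sin (real (Suc (Suc k)) * \<theta>) + 1/2 * sin (real k * \<theta>))"
    proof
      fix \<theta> :: real
      have "sin (real (Suc (Suc k)) * \<theta>) = sin (real (Suc k) * \<theta> + \<theta>)" "sin (real k * \<theta>) = sin (real (Suc k) * \<theta> - \<theta>)"
        by (simp_all add: algebra_simps)
      then show "cos \<theta> * sin (real (Suc k) * \<theta>) = 1/2 * sin (real (Suc (Suc k)) * \<theta>) + 1/2 * sin (real k * \<theta>)"
        by (simp only: sin_add sin_diff) (simp add: field_simps)
    qed
    have "sine_poly (Suc n) (\<lambda>\<theta>. sin (real k * \<theta>))"
    proof (cases k)
      case 0
      then show ?thesis by (simp add: sine_poly_zero)
    next
      case (Suc j)
      then show ?thesis using k sine_poly_sin[of j "Suc n"] by simp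
    qed
    then show "sine_poly (Suc n) (\<lambda>\<theta>. cos \<theta> * sin (real (Suc k) * \<theta>))"
      unfolding eq using k by (intro sine_poly_add sine_poly_cmult sine_poly_sin) auto
  qed
  ultimately show ?thesis by simp
qed

lemma sine_poly_poly: "degree q \<le> n \<Longrightarrow> sine_poly n (\<lambda>\<theta>. poly q (cos \<theta>) * sin \<theta>)"
proof (induction n arbitrary: q)
  case 0
  then obtain a where "q = [:a:]" by (metis degree_eq_zeroE le_zero_eq)
  then show ?case using sine_poly_cmult[OF sine_poly_sin[of 0 0], of a] by simp
next
  case (Suc n)
  obtain a r where q: "q = pCons a r" by (rule pCons_cases)
  have "degree r \<le> n" using Suc.prems q by (simp split: if_splits)
  then have "sine_poly (Suc n) (\<lambda>\<theta>. a * sin \<theta> + cos \<theta> * (poly r (cos \<theta>) * sin \<theta>))"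
    using sine_poly_sin[of 0 "Suc n"] by (intro sine_poly_add sine_poly_cmult sine_poly_cos Suc.IH) auto
  then show ?case by (simp add: q algebra_simps)
qed

lemma abs_sin_nat_le:
  assumes "0 \<le> \<theta>" "\<theta> \<le> pi"
  shows "\<bar>sin (real n * \<theta>)\<bar> \<le> real n * sin \<theta>"
proof (induction n)
  case 0
  then show ?case by simp
next
  case (Suc n)
  have s: "0 \<le> sin \<theta>" using assms by (rule sin_ge_zero)
  have "\<bar>sin (real (Suc n) * \<theta>)\<bar> = \<bar>sin (real n * \<theta>) * cos \<theta> + cos (real n * \<theta>) * sin \<theta>\<bar>"
    by (simp add: algebra_simps sin_add)
  also have "\<dots> \<le> \<bar>sin (real n * \<theta>)\<bar> * \<bar>cos \<theta>\<bar> + \<bar>cos (real n * \<theta>)\<bar> * \<bar>sin \<theta>\<bar>"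
    by (metis abs_mult abs_triangle_ineq)
  also have "\<dots> \<le> \<bar>sin (real n * \<theta>)\<bar> * 1 + 1 * \<bar>sin \<theta>\<bar>"
    by (intro add_mono mult_mono) auto
  finally show ?case using Suc s by (simp add: algebra_simps)
qed

text \<open>A Nikolskii inequality: each sine coefficient of \<open>q (cos \<theta>) sin \<theta>\<close> is at most
  \<open>2 / \<pi>\<close> times the \<open>L\<^sup>1\<close> norm of \<open>q\<close>, and \<open>\<bar>sin (k \<theta>)\<bar> \<le> k sin \<theta>\<close>.\<close>

lemma poly_bound_from_quad:
  assumes deg: "degree q \<le> n" and q2: "quad (q * q) \<le> 2" and t: "t \<in> {-1..1}"
  shows "\<bar>poly q t\<bar> \<le> 2 * (real n + 1)\<^sup>2"
proof -
  define f where "f \<theta> = poly q (cos \<theta>) * sin \<theta>" for \<theta>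
  obtain b where b: "\<And>\<theta>. f \<theta> = (\<Sum>k\<le>n. b k * sin (real (Suc k) * \<theta>))"
    using sine_poly_poly[OF deg] unfolding sine_poly_def f_def by blast
  have bk: "\<bar>b j\<bar> \<le> 2" if "j \<le> n" for j
  proof -
    have "((\<lambda>\<theta>. \<Sum>k\<le>n. b k * (sin (real (Suc k) * \<theta>) * sin (real (Suc j) * \<theta>))) has_integral
        (\<Sum>k\<le>n. b k * (if k = j then pi / 2 else 0))) {0..pi}"
      by (intro has_integral_sum has_integral_mult_right has_integral_sin_sin) simp
    then have I: "((\<lambda>\<theta>. f \<theta> * sin (real (Suc j) * \<theta>)) has_integral (b j * (pi / 2))) {0..pi}"
      using that by (simp add: b sum_distrib_right mult.assoc if_distrib cong: if_cong)
    \<comment> \<open>In place of the Cauchy-Schwarz inequality: \<bar>a\<bar> \<le> (1 + a^2) / 2,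
      whose integral is controlled by \<open>quad_1\<close> and the hypothesis on
      \<open>quad (q * q)\<close>.\<close>
    let ?g = "\<lambda>\<theta>. 1/2 * (poly 1 (cos \<theta>) * sin \<theta>) + 1/2 * (poly (q*q) (cos \<theta>) * sin \<theta>)"
    have G: "(?g has_integral (1/2 * quad 1 + 1/2 * quad (q*q))) {0..pi}"
      unfolding quad_def by (intro has_integral_add has_integral_mult_right integrable_integral quad_integrable)
    have "norm (integral {0..pi} (\<lambda>\<theta>. f \<theta> * sin (real (Suc j) * \<theta>))) \<le> integral {0..pi} ?g"
    proof (rule integral_norm_bound_integral)
      fix x assume x: "x \<in> {0..pi}"
      have s: "sin x \<ge> 0" using x by (auto intro: sin_ge_zero)
      have "norm (f x * sin (real (Suc j) * x)) \<le> \<bar>f x\<bar> * 1"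
        unfolding real_norm_def abs_mult by (intro mult_left_mono abs_sin_le_one abs_ge_zero)
      also have "\<dots> = \<bar>poly q (cos x)\<bar> * sin x" using s by (simp add: f_def abs_mult)
      also have "\<dots> \<le> (1/2 + 1/2 * (poly q (cos x))\<^sup>2) * sin x"
      proof (rule mult_right_mono[OF _ s])
        have "0 \<le> (\<bar>poly q (cos x)\<bar> - 1)\<^sup>2" by simp
        then show "\<bar>poly q (cos x)\<bar> \<le> 1/2 + 1/2 * (poly q (cos x))\<^sup>2"
          by (simp add: power2_diff)
      qed
      finally show "norm (f x * sin (real (Suc j) * x)) \<le> ?g x"
        by (simp add: power2_eq_square algebra_simps)
    qed (use I G in \<open>auto simp: has_integral_integrable_integral\<close>)
    then have "\<bar>b j * (pi / 2)\<bar> \<le> 1/2 * 2 + 1/2 * quad (q*q)"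
      by (simp only: integral_unique[OF I] integral_unique[OF G] quad_1 real_norm_def)
    then have "\<bar>b j\<bar> * (pi / 2) \<le> 2" using q2 by (simp add: abs_mult)
    moreover have "\<bar>b j\<bar> * 1 \<le> \<bar>b j\<bar> * (pi / 2)" using pi_ge_two by (intro mult_left_mono) auto
    ultimately show ?thesis by simp
  qed
  have fb: "\<bar>f \<theta>\<bar> \<le> 2 * (real n + 1)\<^sup>2 * sin \<theta>" if "0 \<le> \<theta>" "\<theta> \<le> pi" for \<theta>
  proof -
    have s: "sin \<theta> \<ge> 0" using that by (rule sin_ge_zero)
    have "\<bar>f \<theta>\<bar> \<le> (\<Sum>k\<le>n. \<bar>b k\<bar> * \<bar>sin (real (Suc k) * \<theta>)\<bar>)"
      unfolding b by (rule order.trans[OF sum_abs]) (simp add: abs_mult)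
    also have "\<dots> \<le> (\<Sum>k\<le>n. 2 * (real (Suc k) * sin \<theta>))"
      using bk that by (intro sum_mono mult_mono abs_sin_nat_le) auto
    also have "\<dots> \<le> (\<Sum>k\<le>n. 2 * ((real n + 1) * sin \<theta>))"
      using s by (intro sum_mono mult_left_mono mult_right_mono) auto
    finally show ?thesis by (simp add: power2_eq_square algebra_simps)
  qed
  \<comment> \<open>The common factor sin \<theta> can be cancelled only where it is positive; the
    endpoints of the interval follow by continuity.\<close>
  have inner: "\<bar>poly q x\<bar> \<le> 2 * (real n + 1)\<^sup>2" if "x \<in> {-1<..<1}" for x
  proof -
    have "0 < arccos x" "arccos x < pi" using that arccos_lt_bounded[of x] by auto
    then have "sin (arccos x) > 0" by (rule sin_gt_zero)
    moreover have "\<bar>poly q x\<bar> * sin (arccos x) \<le> 2 * (real n + 1)\<^sup>2 * sin (arccos x)"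
      using fb[of "arccos x"] that \<open>0 < arccos x\<close> \<open>arccos x < pi\<close> \<open>sin (arccos x) > 0\<close>
      by (simp add: f_def abs_mult)
    ultimately show ?thesis by simp
  qed
  have "closure {-1<..<1::real} = {-1..1}" by simp
  then have "continuous_on (closure {-1<..<1}) (\<lambda>x. \<bar>poly q x\<bar>)" "t \<in> closure {-1<..<1}"
    using t by (auto intro!: continuous_intros)
  then show ?thesis by (rule continuous_le_on_closure) (rule inner)
qed

text \<open>Duality: let q take at each node the sign of the corresponding basis polynomial at t.
  Then q(t) is the sum of the absolute values. At the nodes q^2 \<le> 1, so exact quadrature with
  nonnegative weights bounds \<open>quad (q * q)\<close> by the sum 2 of the weights.\<close>

lemma lebesgue_constant:
  assumes "t \<in> {-1..1}"
  shows "(\<Sum>x\<in>nodes p. \<bar>poly (lag p x) t\<bar>) \<le> 2 * (real p + 1)\<^sup>2"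
proof -
  define c where "c x = sgn (poly (lag p x) t)" for x
  define q where "q = (\<Sum>x\<in>nodes p. smult (c x) (lag p x))"
  have deg: "degree q \<le> p" unfolding q_def
    using degree_lag by (intro degree_sum_le finite_nodes) (auto intro: order.trans[OF degree_smult_le])
  have val: "poly q x = c x" if "x \<in> nodes p" for x
    using that by (simp add: q_def poly_sum poly_lag finite_nodes if_distrib cong: if_cong sum.cong)
  have "quad (q * q) = (\<Sum>x\<in>nodes p. poly (q * q) x * quad (lag p x))"
    using deg degree_mult_le[of q q] by (intro gauss_quadrature) simp
  also have "\<dots> \<le> (\<Sum>x\<in>nodes p. poly 1 x * quad (lag p x))"
    using quad_lag_nonneg by (intro sum_mono mult_right_mono) (auto simp: val c_def sgn_if)
  also have "\<dots> = 2"
    using gauss_quadrature[of 1 p] by (simp add: quad_1)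
  finally have "\<bar>poly q t\<bar> \<le> 2 * (real p + 1)\<^sup>2"
    using deg assms by (intro poly_bound_from_quad) auto
  moreover have "poly q t = (\<Sum>x\<in>nodes p. \<bar>poly (lag p x) t\<bar>)"
    by (simp add: q_def poly_sum c_def sgn_mult_self_eq abs_sgn mult.commute)
  ultimately show ?thesis by simp
qed

section \<open>Polynomial approximation of holomorphic functions\<close>

definition strip :: "real \<Rightarrow> complex set" where
  "strip T = {z. infdist z (of_real ` {-1..1}) < T}"

lemma strip_iff: "z \<in> strip T \<longleftrightarrow> (\<exists>x\<in>{-1..1}. dist z (of_real x) < T)"
  unfolding strip_def by (simp add: infdist_def cINF_less_iff)

text \<open>A Minkowski sum of a segment and a disc, hence open and convex. Convexity lets Cauchy's
  formula be used on the strip without discussing the shape of the contour.\<close>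

lemma strip_sum: "strip T = (\<Union>x\<in>of_real ` {-1..1}. \<Union>y\<in>ball 0 T. {x + y})"
proof (intro set_eqI iffI)
  fix z :: complex assume "z \<in> strip T"
  then obtain x where "x \<in> {-1..1}" "dist z (of_real x) < T" by (auto simp: strip_iff)
  then show "z \<in> (\<Union>x\<in>of_real ` {-1..1}. \<Union>y\<in>ball 0 T. {x + y})"
    by (intro UN_I[of "of_real x"] UN_I[of "z - of_real x"]) (auto simp: dist_norm norm_minus_commute)
next
  fix z :: complex assume "z \<in> (\<Union>x\<in>of_real ` {-1..1}. \<Union>y\<in>ball 0 T. {x + y})"
  then show "z \<in> strip T" by (force simp: strip_iff dist_norm)
qed

lemma open_strip: "open (strip T)"
  unfolding strip_sum by (intro open_sums disjI2) simp

lemma convex_strip: "convex (strip T)"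
  unfolding strip_sum
  by (intro convex_sums convex_linear_image bounded_linear.linear[OF bounded_linear_of_real]) auto

lemma of_real_in_strip: "T > 0 \<Longrightarrow> x \<in> {-1..1} \<Longrightarrow> of_real x \<in> strip T"
  unfolding strip_iff by (intro bexI[of _ x]) auto

section \<open>Cauchy's formula in Joukowski coordinates\<close>

definition jouk :: "complex \<Rightarrow> complex" where
  "jouk z = (z + 1 / z) / 2"

text \<open>The circle of radius r goes to the ellipse with semi-axes a and b, so the image is a cos
  \<phi> + i b sin \<phi>. Compared with the point cos \<phi> of the segment, and using 0 \<le> a -
  1 \<le> b, its distance is at most b; and b < T follows from r < T + sqrt (1 + T^2).\<close>

lemma jouk_in_strip:
  assumes "1 \<le> norm z" "norm z < T + sqrt (1 + T\<^sup>2)"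
  shows "jouk z \<in> strip T"
proof -
  define r where "r = norm z"
  define b where "b = (r - 1 / r) / 2"
  define a where "a = (r + 1 / r) / 2"
  have r: "1 \<le> r" "r > 0" using assms by (auto simp: r_def)
  have "b < T"
  proof -
    let ?R = "T + sqrt (1 + T\<^sup>2)"
    have R: "?R > 1" "r < ?R" using assms r by (auto simp: r_def)
    have "(sqrt (1 + T\<^sup>2))\<^sup>2 = 1 + T\<^sup>2" by simp
    then have "?R * (sqrt (1 + T\<^sup>2) - T) = 1" by (simp add: algebra_simps power2_eq_square)
    then have "1 / ?R = sqrt (1 + T\<^sup>2) - T" using R by (simp add: field_simps)
    moreover have "1 / ?R < 1 / r" using R r by (intro divide_strict_left_mono) auto
    ultimately show ?thesis using R unfolding b_def by simp
  qed
  have b0: "b \<ge> 0" using r by (simp add: b_def field_simps) (metis mult_mono' one_le_mult_iff zero_le_one mult_1)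
  have ab: "0 \<le> a - 1" "a - 1 \<le> b" 
  proof -
    have "0 \<le> (r - 1)\<^sup>2 / (2 * r)" using r by simp
    also have "\<dots> = a - 1" using r by (simp add: a_def field_simps power2_eq_square)
    finally show "0 \<le> a - 1" .
    show "a - 1 \<le> b" using r by (simp add: a_def b_def field_simps)
  qed
  define c where "c = Re z / r"
  define s where "s = Im z / r"
  have cs: "c\<^sup>2 + s\<^sup>2 = 1"
  proof -
    have "(Re z)\<^sup>2 + (Im z)\<^sup>2 = r\<^sup>2" by (simp add: r_def cmod_power2)
    then show ?thesis using r by (simp add: c_def s_def power_divide flip: add_divide_distrib)
  qed
  have c1: "\<bar>c\<bar> \<le> 1" using cs by (metis abs_square_le_1 le_add_same_cancel1 zero_le_power2)
  have z: "z = Complex (r * c) (r * s)" using r by (simp add: c_def s_def complex_eq_iff)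
  have inv: "1 / z = Complex (c / r) (- s / r)"
  proof -
    have "z * Complex (c / r) (- s / r) = 1"
      using r cs unfolding z by (simp add: complex_eq_iff power2_eq_square)
    moreover have "z \<noteq> 0" using r by (auto simp: r_def)
    ultimately show ?thesis by (simp add: field_simps)
  qed
  have "jouk z - of_real c = Complex ((a - 1) * c) (b * s)"
    unfolding jouk_def inv by (subst z) (simp add: complex_eq_iff a_def b_def field_simps)
  then have "(norm (jouk z - of_real c))\<^sup>2 = (a - 1)\<^sup>2 * c\<^sup>2 + b\<^sup>2 * s\<^sup>2"
    by (simp add: cmod_power2 power_mult_distrib)
  also have "\<dots> \<le> b\<^sup>2 * c\<^sup>2 + b\<^sup>2 * s\<^sup>2"
    using ab by (intro add_mono mult_right_mono power_mono) auto
  also have "\<dots> = b\<^sup>2" using cs by (simp flip: distrib_left)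
  finally have "norm (jouk z - of_real c) \<le> b" using b0 by (rule power2_le_imp_le)
  then show ?thesis using \<open>b < T\<close> c1 unfolding strip_iff
    by (intro bexI[of _ c]) (auto simp: dist_norm)
qed

text \<open>The third identity is the Cauchy kernel pulled back by \<open>jouk\<close>, whose
  derivative is (1 - 1/z^2) / 2, in partial fractions. Its poles are the two preimages w and 1/w of
  the same point, and 0.\<close>

lemma jouk_kernel:
  assumes "norm w = 1" "norm z > 1"
  shows "jouk z - jouk w = (z - w) * (z - 1 / w) / (2 * z)" "jouk z \<noteq> jouk w"
    "(1 - 1 / z\<^sup>2) / 2 / (jouk z - jouk w) = 1 / (z - w) + 1 / (z - 1 / w) - 1 / z"
proof -
  have nz: "w \<noteq> 0" "z \<noteq> 0" "z - w \<noteq> 0" using assms by auto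
  have "z \<noteq> 1 / w" using assms by (auto simp: norm_divide)
  then have nz': "z - 1 / w \<noteq> 0" "z * w - 1 \<noteq> 0" using nz by (auto simp: field_simps)
  show 1: "jouk z - jouk w = (z - w) * (z - 1 / w) / (2 * z)"
    using nz by (simp add: jouk_def field_simps)
  show "jouk z \<noteq> jouk w" using 1 nz nz' by auto
  show "(1 - 1 / z\<^sup>2) / 2 / (jouk z - jouk w) = 1 / (z - w) + 1 / (z - 1 / w) - 1 / z"
    unfolding 1 using nz nz'
    by (simp add: divide_simps) (simp add: algebra_simps power2_eq_square)
qed

text \<open>Cauchy's formula on the image contour, rewritten on the circle. The winding number of
  the image curve is not computed geometrically: the formula for the constant function 1 determines
  it, because there the kernel can be integrated directly.\<close>

lemma cauchy_joukowski:
  assumes f: "f holomorphic_on strip T" and r: "1 < r" "r < T + sqrt (1 + T\<^sup>2)"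
    and w: "norm w = 1" "jouk w \<in> strip T"
  shows "((\<lambda>z. f (jouk z) * (1 / (z - w) + 1 / (z - 1 / w) - 1 / z)) has_contour_integral
     (2 * pi * \<i> * f (jouk w))) (circlepath 0 r)"
proof -
  let ?\<gamma> = "circlepath 0 r"
  let ?K = "\<lambda>z. 1 / (z - w) + 1 / (z - 1 / w) - 1 / z"
  have img: "path_image ?\<gamma> = sphere 0 r" using r by simp
  have hol: "jouk holomorphic_on - {0}"
    unfolding jouk_def by (intro holomorphic_intros) auto
  have an: "jouk analytic_on - {0}" using hol by (subst analytic_on_open) auto
  have der: "deriv jouk z = (1 - 1 / z\<^sup>2) / 2" if "z \<noteq> 0" for z
    unfolding jouk_def
    by (rule DERIV_imp_deriv) (use that in \<open>auto intro!: derivative_eq_intros simp: power2_eq_square\<close>)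
  have vp: "valid_path (jouk \<circ> ?\<gamma>)"
    using hol r by (intro valid_path_compose_holomorphic[where S="-{0}"]) auto
  have pi: "path_image (jouk \<circ> ?\<gamma>) \<subseteq> strip T - {jouk w}"
  proof -
    have "jouk z \<in> strip T - {jouk w}" if "norm z = r" for z
      using jouk_in_strip[of z T] jouk_kernel(2)[of w z] w r that by auto
    then show ?thesis unfolding path_image_compose img by auto
  qed
  have closed: "pathfinish (jouk \<circ> ?\<gamma>) = pathstart (jouk \<circ> ?\<gamma>)"
    by (simp add: pathfinish_compose pathstart_compose)
  have cont: "(\<lambda>z. g (jouk z) * ?K z) contour_integrable_on ?\<gamma>"
    if g: "g holomorphic_on strip T" for g
  proof (rule contour_integrable_continuous_circlepath)
    have "continuous_on (sphere 0 r) (\<lambda>z. g (jouk z))"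
      using r by (intro continuous_on_compose2[OF holomorphic_on_imp_continuous_on[OF g]]
          holomorphic_on_imp_continuous_on holomorphic_on_subset[OF hol]) (auto intro: jouk_in_strip)
    moreover have "continuous_on (sphere 0 r) ?K"
      using r w by (intro continuous_intros) (auto simp: norm_divide)
    ultimately show "continuous_on (path_image ?\<gamma>) (\<lambda>z. g (jouk z) * ?K z)"
      unfolding img by (rule continuous_on_mult)
  qed
  have main: "contour_integral ?\<gamma> (\<lambda>z. g (jouk z) * ?K z) =
      2 * pi * \<i> * winding_number (jouk \<circ> ?\<gamma>) (jouk w) * g (jouk w)"
    if g: "g holomorphic_on strip T" for g
  proof -
    have "contour_integral (jouk \<circ> ?\<gamma>) (\<lambda>z. g z / (z - jouk w)) =
        2 * pi * \<i> * winding_number (jouk \<circ> ?\<gamma>) (jouk w) * g (jouk w)"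
      using Cauchy_integral_formula_convex_simple[OF convex_strip g _ vp pi closed] w
      by (intro contour_integral_unique) (simp add: interior_open open_strip)
    moreover have "contour_integral (jouk \<circ> ?\<gamma>) (\<lambda>z. g z / (z - jouk w)) =
        contour_integral ?\<gamma> (\<lambda>z. deriv jouk z * (g (jouk z) / (jouk z - jouk w)))"
      using r by (intro contour_integral_comp_analyticW[OF an]) auto
    moreover have "\<dots> = contour_integral ?\<gamma> (\<lambda>z. g (jouk z) * ?K z)"
    proof (rule contour_integral_eq)
      fix z assume "z \<in> path_image ?\<gamma>"
      then have z: "norm z = r" using r by simp
      then have "z \<noteq> 0" using r by auto
      then have "deriv jouk z / (jouk z - jouk w) = ?K z"
        using jouk_kernel(3)[OF w(1), of z] z r by (simp only: der not_False_eq_True)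
      then show "deriv jouk z * (g (jouk z) / (jouk z - jouk w)) = g (jouk z) * ?K z"
        by (metis mult.commute times_divide_eq_left times_divide_eq_right)
    qed
    ultimately show ?thesis by simp
  qed
  \<comment> \<open>The poles w, 1/w and 0 all lie inside the circle; their residues 1, 1 and -1 add
    up to 1.\<close>
  have "(?K has_contour_integral (2 * pi * \<i> * 1 + 2 * pi * \<i> * 1 - 2 * pi * \<i> * 1)) ?\<gamma>"
  proof (intro has_contour_integral_diff has_contour_integral_add)
    have *: "((\<lambda>z. 1 / (z - a)) has_contour_integral (2 * pi * \<i> * 1)) ?\<gamma>" if "norm a < r" for a
      using Cauchy_integral_circlepath_simple[of "\<lambda>_. 1" 0 r a] that by simp
    show "((\<lambda>z. 1 / (z - w)) has_contour_integral (2 * pi * \<i> * 1)) ?\<gamma>"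
      using w r by (intro *) simp
    show "((\<lambda>z. 1 / (z - 1 / w)) has_contour_integral (2 * pi * \<i> * 1)) ?\<gamma>"
      using w r by (intro *) (simp add: norm_divide)
    show "((\<lambda>z. 1 / z) has_contour_integral (2 * pi * \<i> * 1)) ?\<gamma>"
      using *[of 0] r by simp
  qed
  then have "contour_integral ?\<gamma> ?K = 2 * pi * \<i>" by (simp add: contour_integral_unique)
  then have wn: "winding_number (jouk \<circ> ?\<gamma>) (jouk w) = 1"
    using main[of "\<lambda>_. 1"] by simp
  show ?thesis
    using has_contour_integral_integral[OF cont[OF f]] unfolding main[OF f] wn by simp
qed

section \<open>Chebyshev expansion and its truncation error\<close>

fun cheb :: "nat \<Rightarrow> real poly" where
  "cheb 0 = 1"
| "cheb (Suc 0) = [:0, 1:]"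
| "cheb (Suc (Suc k)) = smult 2 (pCons 0 (cheb (Suc k))) - cheb k"

lemma degree_cheb: "degree (cheb k) \<le> k"
proof (induction k rule: cheb.induct)
  case (3 k)
  have "degree (smult 2 (pCons 0 (cheb (Suc k)))) \<le> Suc (Suc k)"
    using 3 by (auto intro!: order.trans[OF degree_smult_le])
  then show ?case using 3 by (auto intro!: degree_diff_le)
qed auto

lemma poly_cheb_jouk:
  assumes "norm w = 1" "jouk w = of_real t"
  shows "complex_of_real (2 * poly (cheb k) t) = w ^ k + (1 / w) ^ k"
proof (induction k rule: cheb.induct)
  case 1
  then show ?case by simp
next
  case 2
  then show ?case using assms(2) by (simp add: jouk_def flip: assms(2))
next
  case (3 k)
  have w: "w \<noteq> 0" using assms by auto
  have t: "complex_of_real t = (w + 1 / w) / 2" using assms(2) by (simp add: jouk_def)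
  have "complex_of_real (2 * poly (cheb (Suc (Suc k))) t) =
      2 * of_real t * of_real (2 * poly (cheb (Suc k)) t) - of_real (2 * poly (cheb k) t)"
    by (simp add: algebra_simps)
  also have "\<dots> = (w + 1 / w) * (w ^ Suc k + (1 / w) ^ Suc k) - (w ^ k + (1 / w) ^ k)"
    unfolding 3 t by simp
  also have "\<dots> = w ^ Suc (Suc k) + (1 / w) ^ Suc (Suc k) + (w * (1 / w)) * (w ^ k + (1 / w) ^ k) - (w ^ k + (1 / w) ^ k)"
    unfolding power_Suc by (simp only: distrib_left distrib_right ac_simps)
  also have "\<dots> = w ^ Suc (Suc k) + (1 / w) ^ Suc (Suc k)"
    using w by simp
  finally show ?case .
qed

lemma exists_jouk:
  assumes "t \<in> {-1..1}"
  obtains w where "norm w = 1" "jouk w = of_real t"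
proof
  show "norm (cis (arccos t)) = 1" by simp
  have "1 / cis (arccos t) = cis (- arccos t)" by (simp add: cis_divide[of 0, simplified])
  then show "jouk (cis (arccos t)) = of_real t"
    using assms by (simp add: jouk_def complex_eq_iff)
qed

lemma geometric_kernel:
  fixes z w :: complex
  assumes "z \<noteq> 0" "z \<noteq> w"
  shows "1 / (z - w) = (\<Sum>k\<le>n. w ^ k / z ^ Suc k) + (w / z) ^ Suc n / (z - w)"
proof -
  have nz: "z - w \<noteq> 0" using assms by simp
  have "(\<Sum>k\<le>n. w ^ k / z ^ Suc k) * (z - w) = 1 - (w / z) ^ Suc n"
  proof (induction n)
    case 0
    then show ?case using assms by (simp add: field_simps)
  next
    case (Suc n)
    have "w ^ Suc n / z ^ Suc (Suc n) * (z - w) = (w / z) ^ Suc n - (w / z) ^ Suc (Suc n)"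
      using assms by (simp add: field_simps power_divide)
    then show ?case using Suc by (simp only: sum.atMost_Suc distrib_right) simp
  qed
  then have "(\<Sum>k\<le>n. w ^ k / z ^ Suc k) = (1 - (w / z) ^ Suc n) / (z - w)"
    using nz by (metis nonzero_mult_div_cancel_right)
  then show ?thesis by (simp only: diff_divide_distrib) simp
qed

text \<open>In the formula of \<open>cauchy_joukowski\<close> the kernels with poles w and 1/w are
  expanded in geometric series up to order n. The sums w^k + w^(-k) that appear are twice the
  Chebyshev polynomial at t. The two remainders are of size r^(-n-1) / (r - 1), and the length of
  the circle restores one power of r.\<close>

lemma chebyshev_approximation:
  assumes f: "f holomorphic_on strip T" and M: "\<And>z. z \<in> strip T \<Longrightarrow> norm (f z) \<le> M"
    and T: "T > 0" and r: "1 < r" "r < T + sqrt (1 + T\<^sup>2)"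
  shows "\<exists>c. \<forall>t\<in>{-1..1}. norm (f (of_real t) - (\<Sum>k\<le>n. poly (cheb k) t *\<^sub>R c k)) \<le> 2 * M / ((r - 1) * r ^ n)"
proof -
  let ?\<gamma> = "circlepath 0 r"
  define a where "a k = contour_integral ?\<gamma> (\<lambda>z. f (jouk z) * (1 / z ^ Suc k)) / (2 * pi * \<i>)" for k
  \<comment> \<open>The term -1/z of the kernel cancels half of the k = 0 term, where w^0 + w^(-0) =
    2; the other coefficients double because w^k + w^(-k) is twice the value of
    \<open>cheb k\<close>.\<close>
  define c where "c k = (if k = 0 then a 0 else 2 * a k)" for k
  have cont: "continuous_on (sphere 0 r) (\<lambda>z. f (jouk z))"
  proof -
    have "continuous_on (sphere 0 r) jouk" unfolding jouk_def
      using r by (intro continuous_intros) auto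
    then show ?thesis
      using r by (intro continuous_on_compose2[OF holomorphic_on_imp_continuous_on[OF f]])
         (auto intro: jouk_in_strip)
  qed
  have a: "((\<lambda>z. f (jouk z) * (1 / z ^ Suc k)) has_contour_integral (2 * pi * \<i> * a k)) ?\<gamma>" for k
  proof -
    have "(\<lambda>z. f (jouk z) * (1 / z ^ Suc k)) contour_integrable_on ?\<gamma>"
      using r by (intro contour_integrable_continuous_circlepath continuous_intros cont[folded path_image_circlepath])
          (auto intro: continuous_on_subset[OF cont])
    then show ?thesis by (simp add: a_def has_contour_integral_integral)
  qed
  have M0: "M \<ge> 0" using M[OF of_real_in_strip[of T 0]] T norm_ge_zero order.trans by (metis atLeastAtMost_iff le_numeral_extra(1) neg_le_0_iff_le zero_le_one)
  show ?thesis
  proof (intro exI[of _ c] ballI)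
    fix t :: real assume t: "t \<in> {-1..1}"
    obtain w where w: "norm w = 1" "jouk w = of_real t" using exists_jouk[OF t] by blast
    have w0: "w \<noteq> 0" using w by auto
    let ?S = "\<lambda>z. (\<Sum>k\<le>n. f (jouk z) * (1 / z ^ Suc k) * (w ^ k + (1 / w) ^ k)) - f (jouk z) * (1 / z ^ Suc 0)"
    let ?R = "\<lambda>z. f (jouk z) * ((w / z) ^ Suc n / (z - w) + (1 / w / z) ^ Suc n / (z - 1 / w))"
    have "((\<lambda>z. f (jouk z) * (1 / (z - w) + 1 / (z - 1 / w) - 1 / z)) has_contour_integral
        (2 * pi * \<i> * f (of_real t))) ?\<gamma>"
      using cauchy_joukowski[OF f r w(1)] w(2) of_real_in_strip[OF T t] by simp
    moreover have "(?S has_contour_integral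
        ((\<Sum>k\<le>n. 2 * pi * \<i> * a k * (w ^ k + (1 / w) ^ k)) - 2 * pi * \<i> * a 0)) ?\<gamma>"
      by (intro has_contour_integral_diff has_contour_integral_sum has_contour_integral_rmul a) auto
    ultimately have "((\<lambda>z. f (jouk z) * (1 / (z - w) + 1 / (z - 1 / w) - 1 / z) - ?S z) has_contour_integral
        (2 * pi * \<i> * f (of_real t) - ((\<Sum>k\<le>n. 2 * pi * \<i> * a k * (w ^ k + (1 / w) ^ k)) - 2 * pi * \<i> * a 0))) ?\<gamma>"
      by (rule has_contour_integral_diff)
    moreover have E: "(\<Sum>k\<le>n. a k * (w ^ k + (1 / w) ^ k)) - a 0 = (\<Sum>k\<le>n. poly (cheb k) t *\<^sub>R c k)"
    proof -
      have "(\<Sum>k\<le>n. a k * (w ^ k + (1 / w) ^ k)) = (\<Sum>k\<le>n. poly (cheb k) t *\<^sub>R c k + (if k = 0 then a 0 else 0))"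
        unfolding poly_cheb_jouk[OF w, symmetric]
        by (intro sum.cong refl) (auto simp: c_def scaleR_conv_of_real)
      then show ?thesis by (simp add: sum.distrib)
    qed
    moreover have "(\<Sum>k\<le>n. 2 * pi * \<i> * a k * (w ^ k + (1 / w) ^ k)) = 2 * pi * \<i> * (\<Sum>k\<le>n. a k * (w ^ k + (1 / w) ^ k))"
      by (simp add: sum_distrib_left mult.assoc)
    then have "2 * pi * \<i> * f (of_real t) - ((\<Sum>k\<le>n. 2 * pi * \<i> * a k * (w ^ k + (1 / w) ^ k)) - 2 * pi * \<i> * a 0)
       = 2 * pi * \<i> * (f (of_real t) - (\<Sum>k\<le>n. poly (cheb k) t *\<^sub>R c k))"
      unfolding E[symmetric] by (simp only: right_diff_distrib)
    ultimately have I: "((\<lambda>z. f (jouk z) * (1 / (z - w) + 1 / (z - 1 / w) - 1 / z) - ?S z) has_contour_integral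
        (2 * pi * \<i> * (f (of_real t) - (\<Sum>k\<le>n. poly (cheb k) t *\<^sub>R c k)))) ?\<gamma>" by (simp only:)
    have eq: "f (jouk z) * (1 / (z - w) + 1 / (z - 1 / w) - 1 / z) - ?S z = ?R z" if z: "norm z = r" for z
    proof -
      have z: "z \<noteq> 0" "z \<noteq> w" "z \<noteq> 1 / w" using z r w by (auto simp: norm_divide)
      have "(\<Sum>k\<le>n. f (jouk z) * (1 / z ^ Suc k) * (w ^ k + (1 / w) ^ k)) =
        f (jouk z) * ((\<Sum>k\<le>n. w ^ k / z ^ Suc k) + (\<Sum>k\<le>n. (1 / w) ^ k / z ^ Suc k))"
        by (simp add: sum_distrib_left distrib_left sum.distrib)
      then show ?thesis
        by (subst geometric_kernel[OF z(1,2), of n], subst geometric_kernel[OF z(1,3), of n])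
          (simp add: algebra_simps)
    qed
    have bd: "norm (?R z) \<le> M * (2 / ((r - 1) * r ^ Suc n))" if z: "norm z = r" for z
    proof -
      have *: "norm ((v / z) ^ Suc n / (z - v)) \<le> 1 / ((r - 1) * r ^ Suc n)" if "norm v = 1" for v
      proof -
        have "norm (z - v) \<ge> r - 1" using z that norm_triangle_ineq2[of z v] by simp
        then have "1 / r ^ Suc n / norm (z - v) \<le> 1 / r ^ Suc n / (r - 1)"
          using r by (intro divide_left_mono mult_pos_pos) auto
        then show ?thesis using z that
          by (simp only: norm_divide norm_power) (simp add: power_divide mult.commute)
      qed
      have "norm ((w / z) ^ Suc n / (z - w) + (1 / w / z) ^ Suc n / (z - 1 / w)) \<le>
          1 / ((r - 1) * r ^ Suc n) + 1 / ((r - 1) * r ^ Suc n)"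
        by (rule norm_triangle_mono) (rule *, simp add: w norm_divide)+
      then have le: "norm ((w / z) ^ Suc n / (z - w) + (1 / w / z) ^ Suc n / (z - 1 / w)) \<le>
          2 / ((r - 1) * r ^ Suc n)"
        by (simp only: add_divide_distrib[symmetric] one_add_one)
      have "norm (f (jouk z)) \<le> M" using z r by (intro M jouk_in_strip) auto
      then show ?thesis unfolding norm_mult by (rule mult_mono[OF _ le M0 norm_ge_zero])
    qed
    have "norm (2 * pi * \<i> * (f (of_real t) - (\<Sum>k\<le>n. poly (cheb k) t *\<^sub>R c k))) \<le>
       M * (2 / ((r - 1) * r ^ Suc n)) * (2 * pi * r)"
      using r M0 bd eq by (intro has_contour_integral_bound_circlepath[OF I]) auto
    moreover have "M * (2 / ((r - 1) * r ^ Suc n)) * (2 * pi * r) = (2 * pi) * (2 * M / ((r - 1) * r ^ n))"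
      using r by (simp add: field_simps)
    moreover have "norm (2 * pi * \<i> * d) = (2 * pi) * norm d" for d :: complex
      by (simp add: norm_mult)
    ultimately have "(2 * pi) * norm (f (of_real t) - (\<Sum>k\<le>n. poly (cheb k) t *\<^sub>R c k)) \<le>
       (2 * pi) * (2 * M / ((r - 1) * r ^ n))"
      by (simp only:)
    then show "norm (f (of_real t) - (\<Sum>k\<le>n. poly (cheb k) t *\<^sub>R c k)) \<le> 2 * M / ((r - 1) * r ^ n)"
      by (simp only: mult_le_cancel_left_pos pi_gt_zero zero_less_numeral mult_pos_pos)
  qed
qed

section \<open>Interpolation of holomorphic functions\<close>

lemma interp_add: "interp p (\<lambda>x. f x + g x) t = interp p f t + interp p g t"
  by (simp add: interp_eq scaleR_add_right sum.distrib)

lemma interp_poly: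
  assumes "\<And>k. k \<in> K \<Longrightarrow> degree (P k) \<le> p"
  shows "interp p (\<lambda>t. \<Sum>k\<in>K. poly (P k) t *\<^sub>R c k) t = (\<Sum>k\<in>K. poly (P k) t *\<^sub>R c k)"
proof -
  have "interp p (\<lambda>t. \<Sum>k\<in>K. poly (P k) t *\<^sub>R c k) t =
      (\<Sum>k\<in>K. (\<Sum>x\<in>nodes p. poly (lag p x) t * poly (P k) x) *\<^sub>R c k)"
    unfolding interp_eq scaleR_sum_right scaleR_left.sum by (subst sum.swap) simp
  also have "\<dots> = (\<Sum>k\<in>K. poly (P k) t *\<^sub>R c k)"
    using assms by (intro sum.cong refl) (simp add: lagrange_reproduces_poly)
  finally show ?thesis .
qed

lemma norm_interp_le:
  assumes t: "t \<in> {-1..1}" and f: "\<And>x. x \<in> {-1..1} \<Longrightarrow> norm (f x) \<le> B"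
  shows "norm (interp p f t) \<le> 2 * (real p + 1)\<^sup>2 * B"
proof -
  have B: "B \<ge> 0" using f[OF t] norm_ge_zero order.trans by blast
  have "norm (interp p f t) \<le> (\<Sum>x\<in>nodes p. \<bar>poly (lag p x) t\<bar> * B)"
    unfolding interp_eq using f nodes_subset[of p]
    by (intro sum_norm_le) (auto intro!: mult_left_mono)
  also have "\<dots> \<le> 2 * (real p + 1)\<^sup>2 * B"
    unfolding sum_distrib_right[symmetric] by (rule mult_right_mono[OF lebesgue_constant[OF t] B])
  finally show ?thesis .
qed

text \<open>Lebesgue's argument: interpolation reproduces the Chebyshev truncation, so only its
  error is passed through the operator. The degree n is kept apart from p so that two consecutive
  levels can share one approximation rate.\<close>

lemma interp_error:
  assumes f: "f holomorphic_on strip T" and M: "\<And>z. z \<in> strip T \<Longrightarrow> norm (f z) \<le> M"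
    and T: "T > 0" and r: "1 < r" "r < T + sqrt (1 + T\<^sup>2)" and t: "t \<in> {-1..1}" and np: "n \<le> p"
  shows "norm (f (of_real t) - interp p (\<lambda>x. f (of_real x)) t) \<le>
    (1 + 2 * (real p + 1)\<^sup>2) * (2 * M / ((r - 1) * r ^ n))"
proof -
  let ?B = "2 * M / ((r - 1) * r ^ n)"
  obtain c where c: "\<And>t. t \<in> {-1..1} \<Longrightarrow>
      norm (f (of_real t) - (\<Sum>k\<le>n. poly (cheb k) t *\<^sub>R c k)) \<le> ?B"
    using chebyshev_approximation[OF f M T r, of n] by blast
  define q where "q t = (\<Sum>k\<le>n. poly (cheb k) t *\<^sub>R c k)" for t
  define e where "e t = f (of_real t) - q t" for t
  have fe: "(\<lambda>x. f (of_real x)) = (\<lambda>t. q t + e t)" by (simp add: e_def)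
  have iq: "interp p q t = q t"
    unfolding q_def using np by (intro interp_poly) (auto intro: order.trans[OF degree_cheb])
  have "interp p (\<lambda>x. f (of_real x)) t = q t + interp p e t"
    unfolding fe interp_add iq ..
  then have "f (of_real t) - interp p (\<lambda>x. f (of_real x)) t = e t - interp p e t"
    by (simp add: e_def)
  also have "norm \<dots> \<le> ?B + 2 * (real p + 1)\<^sup>2 * ?B"
    using c t by (intro norm_triangle_le_diff add_mono norm_interp_le) (auto simp: e_def q_def)
  finally show ?thesis by (simp only: distrib_right mult_1_left)
qed

lemma one_less_rho:
  assumes "T > 0"
  shows "1 < T + sqrt (1 + T\<^sup>2)"
proof -
  have "1 \<le> sqrt (1 + T\<^sup>2)" by simp
  then show ?thesis using assms by linarith
qed

text \<open>The interpolation errors of levels p - 1 and p are both estimated with the rate for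
  degree p - 1; the lost power of r appears as r / (r - 1) in place of 1 / (r - 1). The function is
  controlled only inside the open strip, so the estimate is made for r < R and r tends to R at the
  end, which keeps the exact rate.\<close>

lemma interp_diff_bound:
  assumes f: "f holomorphic_on strip T" and M: "\<And>z. z \<in> strip T \<Longrightarrow> norm (f z) \<le> M"
    and T: "T > 0" and t: "t \<in> {-1..1}" and R: "R = T + sqrt (1 + T\<^sup>2)" and p: "p > 0"
  shows "norm (interp_diff p (\<lambda>x. f (of_real x)) t) \<le> M * (12 * (R / (R - 1)) * (real p + 1)\<^sup>2 * (1 / R) ^ p)"
proof -
  have M0: "M \<ge> 0" using M[OF of_real_in_strip[OF T t]] norm_ge_zero order.trans by blast
  have R1: "R > 1" unfolding R by (rule one_less_rho[OF T])
  obtain m where m: "p = Suc m" using p by (cases p) auto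
  define F where "F r = M * (12 * (r / (r - 1)) * (real p + 1)\<^sup>2 * (1 / r) ^ p)" for r
  have bound: "norm (interp_diff p (\<lambda>x. f (of_real x)) t) \<le> F r" if r: "1 < r" "r < R" for r
  proof -
    let ?B = "2 * M / ((r - 1) * r ^ m)"
    let ?e = "\<lambda>p. f (of_real t) - interp p (\<lambda>x. f (of_real x)) t"
    have B: "?B \<ge> 0" using r M0 by simp
    have "interp_diff p (\<lambda>x. f (of_real x)) t = ?e m - ?e p"
      by (simp add: interp_diff_def m)
    also have "norm \<dots> \<le> (1 + 2 * (real m + 1)\<^sup>2) * ?B + (1 + 2 * (real p + 1)\<^sup>2) * ?B"
      using r unfolding R
      by (intro norm_triangle_le_diff add_mono interp_error[OF f M T _ _ t]) (auto simp: m)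
    \<comment> \<open>Both 1 + 2 (m + 1)^2 and 1 + 2 (p + 1)^2 are at most 3 (p + 1)^2; two errors
      and the 2 inside the rate make the constant 12.\<close>
    also have "\<dots> \<le> (3 * (real p + 1)\<^sup>2) * ?B + (3 * (real p + 1)\<^sup>2) * ?B"
      using B by (intro add_mono mult_right_mono) (auto simp: m power2_eq_square algebra_simps)
    also have "\<dots> = M * (12 * (1 / ((r - 1) * r ^ m)) * (real p + 1)\<^sup>2)" by simp
    also have "1 / ((r - 1) * r ^ m) = r / (r - 1) * (1 / r) ^ p"
      using r by (simp add: m power_divide)
    also have "M * (12 * (r / (r - 1) * (1 / r) ^ p) * (real p + 1)\<^sup>2) = F r"
      by (simp add: F_def)
    finally show ?thesis .
  qed
  have "(F \<longlongrightarrow> F R) (at_left R)"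
    unfolding F_def using R1 by (intro tendsto_intros) auto
  moreover have "eventually (\<lambda>r. norm (interp_diff p (\<lambda>x. f (of_real x)) t) \<le> F r) (at_left R)"
    using eventually_at_left_real[OF R1] by eventually_elim (auto intro: bound)
  ultimately have "norm (interp_diff p (\<lambda>x. f (of_real x)) t) \<le> F R"
    by (rule tendsto_lowerbound) simp
  then show ?thesis by (simp add: F_def)
qed

lemma interp_diff_0: "interp_diff 0 f t = f 0"
proof -
  have "poly (lag 0 0) t = 1" by (simp add: lag_def nodes_0)
  then show ?thesis by (simp add: interp_diff_def interp_eq nodes_0)
qed

lemma sum_interp_diff: "(\<Sum>k\<le>p. interp_diff k f t) = interp p f t"
  by (induction p) (auto simp: interp_diff_def)

lemma interp_diff_sums:
  assumes f: "f holomorphic_on strip T" and M: "\<And>z. z \<in> strip T \<Longrightarrow> norm (f z) \<le> M"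
    and T: "T > 0" and t: "t \<in> {-1..1}"
  shows "(\<lambda>p. interp_diff p (\<lambda>x. f (of_real x)) t) sums f (of_real t)"
proof -
  let ?R = "T + sqrt (1 + T\<^sup>2)"
  obtain r where r: "1 < r" "r < ?R" using one_less_rho[OF T] dense by blast
  have "(\<lambda>p. (1 + 2 * (real p + 1)\<^sup>2) * (2 * M / ((r - 1) * r ^ p))) \<longlonglongrightarrow> 0"
    using r by real_asymp
  then have "(\<lambda>p. f (of_real t) - interp p (\<lambda>x. f (of_real x)) t) \<longlonglongrightarrow> 0"
    by (rule Lim_null_comparison[rotated])
       (rule always_eventually, rule allI, rule interp_error[OF f M T r t order_refl])
  then have "(\<lambda>p. interp p (\<lambda>x. f (of_real x)) t) \<longlonglongrightarrow> f (of_real t)"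
    using tendsto_diff[OF tendsto_const[of "f (of_real t)"]] by fastforce
  then show ?thesis by (simp add: sums_def_le sum_interp_diff)
qed

section \<open>Tensor products of interpolation operators\<close>

text \<open>Points and coefficients do not depend on f. This is how holomorphy in the other
  variables and convergence of infinite sums pass through the operator.\<close>

lemma interp_diff_lincomb:
  "\<exists>X c. finite X \<and> X \<subseteq> {-1..1} \<and> (\<forall>f :: real \<Rightarrow> 'a::real_vector. interp_diff p f t = (\<Sum>x\<in>X. c x *\<^sub>R f x))"
proof -
  let ?X = "nodes p \<union> nodes (p - 1)"
  let ?c = "\<lambda>x. (if x \<in> nodes p then poly (lag p x) t else 0) -
      (if p \<noteq> 0 \<and> x \<in> nodes (p - 1) then poly (lag (p - 1) x) t else 0)"
  have "interp_diff p f t = (\<Sum>x\<in>?X. ?c x *\<^sub>R f x)" for f :: "real \<Rightarrow> 'a"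
  proof -
    have 1: "interp p f t = (\<Sum>x\<in>?X. (if x \<in> nodes p then poly (lag p x) t else 0) *\<^sub>R f x)"
      unfolding interp_eq by (rule sum.mono_neutral_cong_left) (auto simp: finite_nodes)
    have 2: "(if p = 0 then 0 else interp (p - 1) f t) =
        (\<Sum>x\<in>?X. (if p \<noteq> 0 \<and> x \<in> nodes (p - 1) then poly (lag (p - 1) x) t else 0) *\<^sub>R f x)"
    proof (cases "p = 0")
      case False
      then have "(\<Sum>x\<in>?X. (if p \<noteq> 0 \<and> x \<in> nodes (p - 1) then poly (lag (p - 1) x) t else 0) *\<^sub>R f x)
         = interp (p - 1) f t"
        unfolding interp_eq by (intro sum.mono_neutral_cong_right) (auto simp: finite_nodes)
      then show ?thesis using False by simp
    qed simp
    show ?thesis unfolding interp_diff_def 1 2 by (simp only: scaleR_left_diff_distrib sum_subtractf)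
  qed
  then show ?thesis using nodes_subset finite_nodes by (intro exI[of _ ?X] exI[of _ ?c]) auto
qed

lemma interp_diff_cong:
  assumes "\<And>x. x \<in> {-1..1} \<Longrightarrow> f x = g x"
  shows "interp_diff p f t = interp_diff p g t"
proof -
  have "interp q f t = interp q g t" for q
    unfolding interp_eq using nodes_subset[of q] assms by (intro sum.cong) auto
  then show ?thesis by (simp add: interp_diff_def)
qed

lemma interp_diff_linear:
  assumes "linear L"
  shows "L (interp_diff p f t) = interp_diff p (\<lambda>x. L (f x)) t"
  using assms by (simp add: interp_diff_def interp_eq linear_diff linear_sum linear_cmul linear_0)

text \<open>Unlike \<open>tensor_diff\<close>, it runs over any list of variables, also those of
  level 0, so that inductions over the list are possible and indices with different supports share
  one list.\<close>

definition tens :: "nat list \<Rightarrow> (nat \<Rightarrow> nat) \<Rightarrow> ((nat \<Rightarrow> real) \<Rightarrow> 'h) \<Rightarrow> (nat \<Rightarrow> real) \<Rightarrow> 'h::real_vector" where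
  "tens xs \<alpha> g = foldr (\<lambda>m. in_variable m (interp_diff (\<alpha> m))) xs g"

lemma tens_Nil: "tens [] \<alpha> g y = g y"
  by (simp add: tens_def)

lemma tens_Cons: "tens (a # xs) \<alpha> g y = interp_diff (\<alpha> a) (\<lambda>t. tens xs \<alpha> g (y(a := t))) (y a)"
  by (simp add: tens_def in_variable_def)

lemma tens_snoc: "tens (xs @ [a]) \<alpha> g = tens xs \<alpha> (in_variable a (interp_diff (\<alpha> a)) g)"
  by (simp add: tens_def)

lemma tens_cong_index: "(\<And>m. m \<in> set xs \<Longrightarrow> \<alpha> m = \<beta> m) \<Longrightarrow> tens xs \<alpha> g y = tens xs \<beta> g y"
  by (induction xs arbitrary: y) (auto simp: tens_Nil tens_Cons)

lemma tens_linear: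
  assumes "linear L"
  shows "L (tens xs \<alpha> g y) = tens xs \<alpha> (\<lambda>y. L (g y)) y"
  by (induction xs arbitrary: y) (simp_all add: tens_Nil tens_Cons interp_diff_linear[OF assms])

lemma tens_substitute:
  assumes "a \<notin> set xs"
  shows "tens xs \<alpha> (\<lambda>y. g (y(a := c))) y = tens xs \<alpha> g (y(a := c))"
  using assms by (induction xs arbitrary: y) (auto simp: tens_Nil tens_Cons fun_upd_twist)

lemma tens_filter:
  assumes "distinct xs"
  shows "tens xs \<alpha> g y = tens (filter (\<lambda>m. \<alpha> m \<noteq> 0) xs) \<alpha>
     (\<lambda>y. g (\<lambda>m. if m \<in> set xs \<and> \<alpha> m = 0 then 0 else y m)) y"
  using assms
proof (induction xs arbitrary: y)
  case Nil
  then show ?case by (simp add: tens_Nil)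
next
  case (Cons a xs)
  let ?fs = "filter (\<lambda>m. \<alpha> m \<noteq> 0) xs"
  show ?case
  proof (cases "\<alpha> a = 0")
    case True
    have a: "a \<notin> set ?fs" using Cons by auto
    have "tens (a # xs) \<alpha> g y = tens xs \<alpha> g (y(a := 0))"
      using True by (simp add: tens_Cons interp_diff_0)
    also have "\<dots> = tens ?fs \<alpha> (\<lambda>y. g (\<lambda>m. if m \<in> set xs \<and> \<alpha> m = 0 then 0 else y m)) (y(a := 0))"
      using Cons by simp
    also have "\<dots> = tens ?fs \<alpha> (\<lambda>y. g (\<lambda>m. if m \<in> set xs \<and> \<alpha> m = 0 then 0 else (y(a := 0)) m)) y"
      by (subst tens_substitute[OF a, symmetric]) simp
    also have "(\<lambda>y. g (\<lambda>m. if m \<in> set xs \<and> \<alpha> m = 0 then 0 else (y(a := 0)) m)) =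
        (\<lambda>y. g (\<lambda>m. if m \<in> set (a # xs) \<and> \<alpha> m = 0 then 0 else y m))"
      using True by (intro ext arg_cong[where f=g]) auto
    finally show ?thesis using True by simp
  next
    case False
    then have eq: "(\<lambda>y. g (\<lambda>m. if m \<in> set (a # xs) \<and> \<alpha> m = 0 then 0 else y m)) =
        (\<lambda>y. g (\<lambda>m. if m \<in> set xs \<and> \<alpha> m = 0 then 0 else y m))"
      by (intro ext arg_cong[where f=g]) auto
    show ?thesis unfolding eq using Cons False by (simp add: tens_Cons)
  qed
qed

lemma tensor_diff_tens:
  assumes "supp \<alpha> \<subseteq> {..<n}"
  shows "tensor_diff \<alpha> v = tens [0..<n] \<alpha> (\<lambda>y. v (\<lambda>m. if m < n then y m else 0))"
proof -
  have "filter (\<lambda>m. \<alpha> m \<noteq> 0) [0..<n] = sorted_list_of_set (supp \<alpha>)"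
  proof -
    have "set (filter (\<lambda>m. \<alpha> m \<noteq> 0) [0..<n]) = supp \<alpha>" using assms by (auto simp: supp_def)
    then show ?thesis by (metis distinct_filter distinct_upt sorted_list_of_set.idem_if_sorted_distinct sorted_upt sorted_wrt_filter)
  qed
  moreover have "(\<lambda>y. v (\<lambda>m. if m < n then if m \<in> set [0..<n] \<and> \<alpha> m = 0 then 0 else y m else 0)) =
      (\<lambda>y. v (\<lambda>m. if m \<in> supp \<alpha> then y m else 0))"
    using assms by (intro ext arg_cong[where f=v]) (auto simp: supp_def)
  ultimately show ?thesis
    using tens_filter[of "[0..<n]" \<alpha> "\<lambda>y. v (\<lambda>m. if m < n then y m else 0)"]
    by (intro ext) (simp only: tensor_diff_def tens_def distinct_upt)
qed

section \<open>Propagating bounds through the variables\<close>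

definition part_region :: "(nat \<Rightarrow> real) \<Rightarrow> nat set \<Rightarrow> (nat \<Rightarrow> complex) set" where
  "part_region \<tau> S = {z. \<forall>m. z m \<in> (if m \<in> S then strip (\<tau> m) else of_real ` {-1..1})}"

text \<open>The extension G is complex in the variables of S only, and holomorphic in each of them
  separately, which is what the one-variable estimates consume. As operators are applied, S shrinks
  and M is multiplied by the corresponding bound.\<close>

definition adm :: "(nat \<Rightarrow> real) \<Rightarrow> nat set \<Rightarrow> real \<Rightarrow> ((nat \<Rightarrow> real) \<Rightarrow> complex) \<Rightarrow> bool" where
  "adm \<tau> S M g \<longleftrightarrow> (\<exists>G. (\<forall>z\<in>part_region \<tau> S. norm (G z) \<le> M \<and>
       (\<forall>m\<in>S. (\<lambda>t. G (z(m := t))) holomorphic_on strip (\<tau> m))) \<and>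
     (\<forall>y\<in>Gam. G (\<lambda>m. of_real (y m)) = g y))"

text \<open>At \<open>p = 0\<close> the bound is exactly 1, so the product of the bounds over all but finitely
  many variables is harmless.\<close>

definition diff_bound :: "real \<Rightarrow> nat \<Rightarrow> real" where
  "diff_bound R p = (if p = 0 then 1 else 12 * (R / (R - 1)) * (real p + 1)\<^sup>2 * (1 / R) ^ p)"

lemma diff_bound_nonneg: "R > 1 \<Longrightarrow> diff_bound R p \<ge> 0"
  by (simp add: diff_bound_def)

lemma rho_gt_1: "\<tau> m > 0 \<Longrightarrow> rho \<tau> m > 1"
  unfolding rho_def by (rule one_less_rho)

lemma summable_diff_bound:
  assumes "R > 1"
  shows "summable (diff_bound R)"
proof -
  define a where "a = ln R"
  have a: "a > 0" using assms by (simp add: a_def)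
  have eq: "(1 / R) ^ p = exp (- a * real p)" for p
    using assms by (simp add: a_def exp_of_nat2_mult exp_minus power_inverse inverse_eq_divide power_one_over)
  have "summable (\<lambda>p. norm (exp (- (a / 2)) ^ p))"
    using a by (simp add: summable_geometric_iff norm_power)
  also have "(\<lambda>p. norm (exp (- (a / 2)) ^ p)) = (\<lambda>p. norm (exp (- (a / 2) * real p)))"
    by (simp only: exp_of_nat2_mult)
  finally have "summable (\<lambda>p. norm (exp (- (a / 2) * real p)))" .
  moreover have "(\<lambda>p. (real p + 1)\<^sup>2 * exp (- a * real p)) \<in> O(\<lambda>p. exp (- (a / 2) * real p))"
    using a by real_asymp
  ultimately have "summable (\<lambda>p. (real p + 1)\<^sup>2 * (1 / R) ^ p)"
    unfolding eq by (rule summable_comparison_test_bigo)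
  then have "summable (\<lambda>p. 12 * (R / (R - 1)) * ((real p + 1)\<^sup>2 * (1 / R) ^ p))"
    by (rule summable_mult)
  then show ?thesis
    by (rule summable_cong[THEN iffD1, rotated])
       (auto simp: diff_bound_def mult.assoc eventually_at_top_linorder intro!: exI[of _ 1])
qed

lemma interp_diff_bound':
  assumes f: "f holomorphic_on strip T" and M: "\<And>z. z \<in> strip T \<Longrightarrow> norm (f z) \<le> M"
    and T: "T > 0" and t: "t \<in> {-1..1}" and R: "R = T + sqrt (1 + T\<^sup>2)"
  shows "norm (interp_diff p (\<lambda>x. f (of_real x)) t) \<le> M * diff_bound R p"
proof (cases "p = 0")
  case True
  then show ?thesis using M[OF of_real_in_strip[OF T, of 0]] by (simp add: interp_diff_0 diff_bound_def)
next
  case False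
  then show ?thesis using interp_diff_bound[OF f M T t R] by (simp add: diff_bound_def)
qed

lemma of_real_in_part_region:
  assumes "y \<in> Gam" "\<And>m. \<tau> m > 0"
  shows "(\<lambda>m. of_real (y m)) \<in> part_region \<tau> S"
  using assms by (auto simp: part_region_def Gam_def intro!: of_real_in_strip)

lemma Gam_upd: "y \<in> Gam \<Longrightarrow> t \<in> {-1..1} \<Longrightarrow> y(m := t) \<in> Gam"
  by (auto simp: Gam_def)

lemma adm_bound:
  assumes "adm \<tau> S M g" "y \<in> Gam" "\<And>m. \<tau> m > 0"
  shows "norm (g y) \<le> M"
proof -
  obtain G where G: "\<forall>z\<in>part_region \<tau> S. norm (G z) \<le> M" "\<forall>y\<in>Gam. G (\<lambda>m. of_real (y m)) = g y"
    using assms(1) unfolding adm_def by blast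
  then show ?thesis using of_real_in_part_region[of y \<tau> S] assms(2,3) by fastforce
qed

lemma adm_interp_diff:
  assumes adm: "adm \<tau> S M g" and m: "m \<in> S" and \<tau>: "\<And>m. \<tau> m > 0"
  shows "adm \<tau> (S - {m}) (M * diff_bound (rho \<tau> m) p) (in_variable m (interp_diff p) g)"
proof -
  obtain G where G: "\<And>z. z \<in> part_region \<tau> S \<Longrightarrow> norm (G z) \<le> M"
      "\<And>z k. z \<in> part_region \<tau> S \<Longrightarrow> k \<in> S \<Longrightarrow> (\<lambda>t. G (z(k := t))) holomorphic_on strip (\<tau> k)"
      "\<And>y. y \<in> Gam \<Longrightarrow> G (\<lambda>m. of_real (y m)) = g y"
    using adm unfolding adm_def by metis
  \<comment> \<open>Since m leaves S, the coordinate z m is real on the smaller region, and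
    \<open>Re\<close> merely converts it.\<close>
  define G' where "G' z = interp_diff p (\<lambda>t. G (z(m := of_real t))) (Re (z m))" for z
  have sub: "part_region \<tau> (S - {m}) \<subseteq> part_region \<tau> S"
  proof
    fix z assume z: "z \<in> part_region \<tau> (S - {m})"
    show "z \<in> part_region \<tau> S"
      unfolding part_region_def
    proof (intro CollectI allI)
      fix k
      have "z k \<in> (if k \<in> S - {m} then strip (\<tau> k) else of_real ` {-1..1})"
        using z by (auto simp: part_region_def)
      then show "z k \<in> (if k \<in> S then strip (\<tau> k) else of_real ` {-1..1})"
        using of_real_in_strip[OF \<tau>[of k]] by (auto split: if_splits)
    qed
  qed
  have upd: "z(m := t) \<in> part_region \<tau> S" if "z \<in> part_region \<tau> S" "t \<in> strip (\<tau> m)" for z t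
    unfolding part_region_def
  proof (intro CollectI allI)
    fix k
    have "z k \<in> (if k \<in> S then strip (\<tau> k) else of_real ` {-1..1})"
      using that by (auto simp: part_region_def)
    then show "(z(m := t)) k \<in> (if k \<in> S then strip (\<tau> k) else of_real ` {-1..1})"
      using that m by (cases "k = m") auto
  qed
  have b: "norm (G' z) \<le> M * diff_bound (rho \<tau> m) p" if z: "z \<in> part_region \<tau> (S - {m})" for z
  proof -
    have "z m \<in> of_real ` {-1..1}" using z unfolding part_region_def by (auto dest: spec[of _ m])
    then have "Re (z m) \<in> {-1..1}" by auto
    then show ?thesis unfolding G'_def
      using z sub by (intro interp_diff_bound'[where T="\<tau> m" and f="\<lambda>t. G (z(m := t))"])
        (auto intro!: G upd \<tau> m simp: rho_def)
  qed
  have h: "(\<lambda>t. G' (z(k := t))) holomorphic_on strip (\<tau> k)"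
    if z: "z \<in> part_region \<tau> (S - {m})" and k: "k \<in> S - {m}" for z k
  proof -
    obtain X c where X: "finite X" "X \<subseteq> {-1..1}"
      "\<And>f :: real \<Rightarrow> complex. interp_diff p f (Re (z m)) = (\<Sum>x\<in>X. c x *\<^sub>R f x)"
      using interp_diff_lincomb[of p "Re (z m)"] by metis
    have "(\<lambda>t. G' (z(k := t))) = (\<lambda>t. \<Sum>x\<in>X. of_real (c x) * G ((z(m := of_real x))(k := t)))"
      using k by (auto simp: G'_def X fun_upd_twist scaleR_conv_of_real)
    moreover have "(\<lambda>t. \<Sum>x\<in>X. of_real (c x) * G ((z(m := of_real x))(k := t))) holomorphic_on strip (\<tau> k)"
    proof (intro holomorphic_intros G)
      fix x assume "x \<in> X"
      then show "z(m := of_real x) \<in> part_region \<tau> S"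
        using z sub X(2) by (intro upd of_real_in_strip \<tau>) auto
    qed (use k in auto)
    ultimately show ?thesis by simp
  qed
  have "G' (\<lambda>m. of_real (y m)) = in_variable m (interp_diff p) g y" if y: "y \<in> Gam" for y
    unfolding G'_def in_variable_def Re_complex_of_real
  proof (rule interp_diff_cong)
    fix x :: real assume "x \<in> {-1..1}"
    moreover have "(\<lambda>m. complex_of_real (y m))(m := of_real x) = (\<lambda>k. of_real ((y(m := x)) k))" by auto
    ultimately show "G ((\<lambda>m. complex_of_real (y m))(m := of_real x)) = g (y(m := x))"
      using G(3)[OF Gam_upd[OF y, of x m]] by simp
  qed
  then show ?thesis unfolding adm_def using b h by blast
qed

lemma adm_tens:
  assumes "adm \<tau> S M g" "distinct xs" "set xs \<subseteq> S" "\<And>m. \<tau> m > 0"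
  shows "adm \<tau> (S - set xs) (M * (\<Prod>m\<in>set xs. diff_bound (rho \<tau> m) (\<alpha> m))) (tens xs \<alpha> g)"
  using assms(1-3)
\<comment> \<open>Reverse induction, because the last variable of the list is the innermost in
  \<open>foldr\<close>: its operator acts first and is the first to leave S.\<close>
proof (induction xs arbitrary: S M g rule: rev_induct)
  case Nil
  then show ?case by (simp add: tens_def)
next
  case (snoc a xs)
  have "adm \<tau> (S - {a}) (M * diff_bound (rho \<tau> a) (\<alpha> a)) (in_variable a (interp_diff (\<alpha> a)) g)"
    using snoc.prems by (intro adm_interp_diff assms(4)) auto
  from snoc.IH[OF this] have "adm \<tau> (S - {a} - set xs)
      (M * diff_bound (rho \<tau> a) (\<alpha> a) * (\<Prod>m\<in>set xs. diff_bound (rho \<tau> m) (\<alpha> m))) (tens (xs @ [a]) \<alpha> g)"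
    using snoc.prems by (auto simp: tens_snoc)
  moreover have "S - {a} - set xs = S - set (xs @ [a])" by auto
  moreover have "a \<notin> set xs" using snoc.prems by auto
  ultimately show ?case by (simp add: mult.assoc)
qed

lemma norm_tens_le:
  assumes "adm \<tau> S M g" "distinct xs" "set xs \<subseteq> S" "\<And>m. \<tau> m > 0" "y \<in> Gam"
  shows "norm (tens xs \<alpha> g y) \<le> M * (\<Prod>m\<in>set xs. diff_bound (rho \<tau> m) (\<alpha> m))"
  by (rule adm_bound[OF adm_tens[OF assms(1-4)] assms(5,4)])

section \<open>Unconditional sums over multi-indices\<close>

lemma sum_prod_weights_le:
  fixes w :: "nat \<Rightarrow> nat \<Rightarrow> real"
  assumes X: "finite X" and F: "finite F" "\<And>\<alpha>. \<alpha> \<in> F \<Longrightarrow> supp \<alpha> \<subseteq> X"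
    and w: "\<And>m p. w m p \<ge> 0" "\<And>m. summable (w m)"
  shows "(\<Sum>\<alpha>\<in>F. \<Prod>m\<in>X. w m (\<alpha> m)) \<le> (\<Prod>m\<in>X. suminf (w m))"
proof -
  \<comment> \<open>A level bound for all of F: restriction to X then embeds F into a finite box,
    over which the sum of products is the product of sums.\<close>
  define P where "P = Max (insert 0 ((\<lambda>(\<alpha>, m). \<alpha> m) ` (F \<times> X)))"
  have P: "\<alpha> m \<le> P" if "\<alpha> \<in> F" "m \<in> X" for \<alpha> m
    unfolding P_def using that X F by (intro Max_ge) force+
  have inj: "inj_on (\<lambda>\<alpha>. restrict \<alpha> X) F"
  proof (rule inj_onI, rule ext)
    fix \<alpha> \<beta> m assume *: "\<alpha> \<in> F" "\<beta> \<in> F" "restrict \<alpha> X = restrict \<beta> X"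
    show "\<alpha> m = \<beta> m"
    proof (cases "m \<in> X")
      case True
      then show ?thesis using fun_cong[OF *(3), of m] by simp
    next
      case False
      then have "m \<notin> supp \<alpha>" "m \<notin> supp \<beta>" using F(2) * by blast+
      then show ?thesis by (simp add: supp_def)
    qed
  qed
  have "(\<Sum>\<alpha>\<in>F. \<Prod>m\<in>X. w m (\<alpha> m)) = (\<Sum>g\<in>(\<lambda>\<alpha>. restrict \<alpha> X) ` F. \<Prod>m\<in>X. w m (g m))"
    by (subst sum.reindex[OF inj]) simp
  also have "\<dots> \<le> (\<Sum>g\<in>PiE X (\<lambda>_. {..P}). \<Prod>m\<in>X. w m (g m))"
    using P X w by (intro sum_mono2 finite_PiE prod_nonneg) auto
  also have "\<dots> = (\<Prod>m\<in>X. \<Sum>p\<le>P. w m p)"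
    using X by (subst prod_sum_PiE) auto
  also have "\<dots> \<le> (\<Prod>m\<in>X. suminf (w m))"
    using w by (intro prod_mono conjI sum_nonneg sum_le_suminf) auto
  finally show ?thesis .
qed

lemma summable_prod_weights:
  fixes w :: "nat \<Rightarrow> nat \<Rightarrow> real"
  assumes X: "finite X" and w: "\<And>m p. w m p \<ge> 0" "\<And>m. summable (w m)"
  shows "(\<lambda>\<alpha>. \<Prod>m\<in>X. w m (\<alpha> m)) summable_on {\<alpha>. supp \<alpha> \<subseteq> X}"
proof (rule nonneg_bdd_above_summable_on)
  show "bdd_above (sum (\<lambda>\<alpha>. \<Prod>m\<in>X. w m (\<alpha> m)) ` {F. F \<subseteq> {\<alpha>. supp \<alpha> \<subseteq> X} \<and> finite F})"
    using X w by (intro bdd_aboveI2[where M="\<Prod>m\<in>X. suminf (w m)"] sum_prod_weights_le) auto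
qed (auto intro: prod_nonneg w)

lemma has_sum_interp_diff:
  fixes F :: "'i \<Rightarrow> real \<Rightarrow> complex"
  assumes "\<And>x. x \<in> {-1..1} \<Longrightarrow> ((\<lambda>i. F i x) has_sum f x) A"
  shows "((\<lambda>i. interp_diff p (F i) t) has_sum interp_diff p f t) A"
proof -
  obtain X c where X: "finite X" "X \<subseteq> {-1..1}"
      "\<And>f :: real \<Rightarrow> complex. interp_diff p f t = (\<Sum>x\<in>X. c x *\<^sub>R f x)"
    using interp_diff_lincomb[of p t] by metis
  have "((\<lambda>i. \<Sum>x\<in>Y. of_real (c x) * F i x) has_sum (\<Sum>x\<in>Y. of_real (c x) * f x)) A"
    if "finite Y" "Y \<subseteq> X" for Y
    using that
  proof (induction Y)
    case (insert x Y)
    then have "((\<lambda>i. of_real (c x) * F i x + (\<Sum>x\<in>Y. of_real (c x) * F i x)) has_sum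
        (of_real (c x) * f x + (\<Sum>x\<in>Y. of_real (c x) * f x))) A"
      using X(2) by (intro has_sum_add has_sum_cmult_right assms) auto
    then show ?case using insert by simp
  qed simp
  then show ?thesis unfolding X(3) scaleR_conv_of_real using X(1) by blast
qed

lemma interp_diff_has_sum:
  assumes f: "f holomorphic_on strip T" and M: "\<And>z. z \<in> strip T \<Longrightarrow> norm (f z) \<le> M"
    and T: "T > 0" and t: "t \<in> {-1..1}"
  shows "((\<lambda>p. interp_diff p (\<lambda>x. f (of_real x)) t) has_sum f (of_real t)) UNIV"
proof (rule norm_summable_imp_has_sum)
  have "summable (\<lambda>p. M * diff_bound (T + sqrt (1 + T\<^sup>2)) p)"
    by (intro summable_mult summable_diff_bound one_less_rho T)
  then show "summable (\<lambda>p. norm (interp_diff p (\<lambda>x. f (of_real x)) t))"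
    by (rule summable_comparison_test[rotated])
       (auto intro!: exI[of _ 0] interp_diff_bound'[OF f M T t refl])
qed (rule interp_diff_sums[OF f M T t])

text \<open>Induction over the variables: each index splits into its level p in the variable a and
  an index supported in the remaining list. For fixed p the inner sum passes through the operator of
  level p; the outer sum is the one-variable expansion of g in the coordinate a.\<close>

lemma tens_has_sum:
  assumes adm: "adm \<tau> S M g" and \<tau>: "\<And>m. \<tau> m > 0"
    and "distinct xs" "set xs \<subseteq> S" "y \<in> Gam"
  shows "((\<lambda>\<alpha>. tens xs \<alpha> g y) has_sum g y) {\<alpha>. supp \<alpha> \<subseteq> set xs}"
  using assms(3-)
proof (induction xs arbitrary: y)
  case Nil
  have "{\<alpha>. supp \<alpha> \<subseteq> {}} = {\<lambda>_. 0}" by (auto simp: supp_def)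
  then show ?case using has_sum_finite[of "{\<lambda>_. 0 :: nat}" "\<lambda>\<alpha>. tens [] \<alpha> g y"] by (simp add: tens_Nil)
next
  case (Cons a xs)
  obtain G where G: "\<And>z. z \<in> part_region \<tau> S \<Longrightarrow> norm (G z) \<le> M"
      "\<And>z k. z \<in> part_region \<tau> S \<Longrightarrow> k \<in> S \<Longrightarrow> (\<lambda>t. G (z(k := t))) holomorphic_on strip (\<tau> k)"
      "\<And>y. y \<in> Gam \<Longrightarrow> G (\<lambda>m. of_real (y m)) = g y"
    using adm unfolding adm_def by metis
  let ?A = "{\<alpha>. supp \<alpha> \<subseteq> set xs}" and ?B = "{\<alpha>. supp \<alpha> \<subseteq> set (a # xs)}"
  let ?h = "\<lambda>(p, \<alpha>). \<alpha>(a := p)"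
  have a: "a \<notin> set xs" "a \<in> S" using Cons.prems by auto
  have T: "tens (a # xs) (\<alpha>(a := p)) g y = interp_diff p (\<lambda>t. tens xs \<alpha> g (y(a := t))) (y a)" for \<alpha> p
  proof -
    have "tens xs (\<alpha>(a := p)) g z = tens xs \<alpha> g z" for z
      using a by (intro tens_cong_index) auto
    then show ?thesis by (simp add: tens_Cons)
  qed
  have inj: "inj_on ?h (UNIV \<times> ?A)"
  proof (rule inj_onI, clarify)
    fix p q \<alpha> \<beta> assume "supp \<alpha> \<subseteq> set xs" "supp \<beta> \<subseteq> set xs" and eq: "\<alpha>(a := p) = \<beta>(a := q)"
    then have 0: "\<alpha> a = 0" "\<beta> a = 0" using a by (auto simp: supp_def)
    have "\<alpha> m = \<beta> m" for m using 0 fun_cong[OF eq, of m] by (cases "m = a") auto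
    then show "p = q \<and> \<alpha> = \<beta>" using fun_cong[OF eq, of a] by auto
  qed
  have img: "?h ` (UNIV \<times> ?A) = ?B"
  proof
    show "?h ` (UNIV \<times> ?A) \<subseteq> ?B" by (auto simp: supp_def split: if_splits)
    show "?B \<subseteq> ?h ` (UNIV \<times> ?A)"
    proof
      fix \<alpha> assume "\<alpha> \<in> ?B"
      then have "\<alpha>(a := 0) \<in> ?A" by (auto simp: supp_def split: if_splits)
      then show "\<alpha> \<in> ?h ` (UNIV \<times> ?A)" by (intro image_eqI[of _ _ "(\<alpha> a, \<alpha>(a := 0))"]) auto
    qed
  qed
  \<comment> \<open>Absolute summability over the whole index set, from the product bounds, allows
    the sum to be evaluated as an iterated one.\<close>
  have "(\<lambda>\<alpha>. M * (\<Prod>m\<in>set (a # xs). diff_bound (rho \<tau> m) (\<alpha> m))) summable_on ?B"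
    by (intro summable_on_cmult_right summable_prod_weights diff_bound_nonneg summable_diff_bound rho_gt_1 \<tau>) auto
  then have "(\<lambda>\<alpha>. norm (tens (a # xs) \<alpha> g y)) summable_on ?B"
    by (rule summable_on_comparison_test)
       (rule norm_tens_le[OF adm Cons.prems(1,2) \<tau> Cons.prems(3)], rule norm_ge_zero)
  then have "(\<lambda>\<alpha>. tens (a # xs) \<alpha> g y) summable_on ?B" by (rule abs_summable_summable)
  then have sm: "((\<lambda>\<alpha>. tens (a # xs) \<alpha> g y) \<circ> ?h) summable_on (UNIV \<times> ?A)"
    using summable_on_reindex[OF inj, of "\<lambda>\<alpha>. tens (a # xs) \<alpha> g y"] unfolding img by simp
  have "(((\<lambda>\<alpha>. tens (a # xs) \<alpha> g y) \<circ> ?h) has_sum g y) (UNIV \<times> ?A)"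
  proof (rule has_sum_SigmaI[OF _ _ sm])
    fix p :: nat
    show "((\<lambda>\<alpha>. ((\<lambda>\<alpha>. tens (a # xs) \<alpha> g y) \<circ> ?h) (p, \<alpha>)) has_sum
        interp_diff p (\<lambda>t. g (y(a := t))) (y a)) ?A"
      unfolding o_def split_conv T
      using Cons.prems by (intro has_sum_interp_diff Cons.IH Gam_upd) auto
  next
    let ?z = "\<lambda>m. complex_of_real (y m)"
    have z: "?z \<in> part_region \<tau> S" by (rule of_real_in_part_region[OF Cons.prems(3) \<tau>])
    have ya: "y a \<in> {-1..1}" using Cons.prems by (auto simp: Gam_def)
    have upd: "?z(a := of_real x) = (\<lambda>m. complex_of_real ((y(a := x)) m))" for x by auto
    have ez: "(\<lambda>k. complex_of_real ((y(a := y a)) k)) = ?z" by auto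
    have nb: "norm (G (?z(a := t))) \<le> M" if "t \<in> strip (\<tau> a)" for t
    proof (rule G(1))
      show "?z(a := t) \<in> part_region \<tau> S"
        unfolding part_region_def
      proof (intro CollectI allI)
        fix k
        have "?z k \<in> (if k \<in> S then strip (\<tau> k) else of_real ` {-1..1})"
          using z unfolding part_region_def by blast
        then show "(?z(a := t)) k \<in> (if k \<in> S then strip (\<tau> k) else of_real ` {-1..1})"
          using that a by (cases "k = a") auto
      qed
    qed
    have "((\<lambda>p. interp_diff p (\<lambda>x. G (?z(a := of_real x))) (y a)) has_sum G (?z(a := of_real (y a)))) UNIV"
      by (rule interp_diff_has_sum[OF G(2)[OF z a(2)] nb \<tau> ya])
    moreover have "interp_diff p (\<lambda>x. G (?z(a := of_real x))) (y a) = interp_diff p (\<lambda>t. g (y(a := t))) (y a)" for p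
      unfolding upd using Cons.prems by (intro interp_diff_cong G(3) Gam_upd) auto
    moreover have "G (?z(a := of_real (y a))) = g y"
      unfolding upd ez by (rule G(3)[OF Cons.prems(3)])
    ultimately show "((\<lambda>p. interp_diff p (\<lambda>t. g (y(a := t))) (y a)) has_sum g y) UNIV" by simp
  qed
  then have "((\<lambda>\<alpha>. tens (a # xs) \<alpha> g y) has_sum g y) (?h ` (UNIV \<times> ?A))"
    using has_sum_reindex[OF inj] by blast
  then show ?case unfolding img .
qed

section \<open>Weighted sums over multi-indices\<close>

text \<open>The sum over the indices is dominated by a product of one-variable sums, each with first
  term 1. Every term with p \<ge> 1 contains a factor b_m, so the rest of the sum is at most D b_m
  with D depending only on K and the uniform bound c < 1. Then 1 + D b_m \<le> exp (D b_m), and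
  summability of b bounds the product independently of the finitely many variables involved.\<close>

lemma weighted_index_sum:
  fixes b :: "nat \<Rightarrow> real"
  assumes b: "summable b" "\<And>m. 0 \<le> b m" "\<And>m. b m \<le> c" and c: "c < 1" and K: "K \<ge> 0"
  obtains S where "S \<ge> 1" "\<And>F. finite F \<Longrightarrow> (\<And>\<alpha>. \<alpha> \<in> F \<Longrightarrow> finite (supp \<alpha>)) \<Longrightarrow>
    (\<Sum>\<alpha>\<in>F. \<Prod>m\<in>supp \<alpha>. K * (real (\<alpha> m) + 1)\<^sup>2 * b m ^ \<alpha> m) \<le> S"
proof
  define W where "W m p = (if p = 0 then 1 else K * (real p + 1)\<^sup>2 * b m ^ p)" for m p
  have c0: "0 \<le> c" using b(2)[of 0] b(3)[of 0] by simp
  have sumC: "summable (\<lambda>p. K * ((real p + 2)\<^sup>2 * c ^ p))"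
  proof (rule summable_mult, rule root_test_convergence)
    show "(\<lambda>p. root p (norm ((real p + 2)\<^sup>2 * c ^ p))) \<longlonglongrightarrow> 1 * c"
    proof (rule Lim_transform_eventually)
      show "(\<lambda>p. (real p + 2) powr (2 / real p) * c) \<longlonglongrightarrow> 1 * c"
        by (intro tendsto_mult tendsto_const) real_asymp
      show "eventually (\<lambda>p. (real p + 2) powr (2 / real p) * c = root p (norm ((real p + 2)\<^sup>2 * c ^ p))) sequentially"
        using eventually_gt_at_top[of 0]
      proof eventually_elim
        case (elim p)
        have "root p (norm ((real p + 2)\<^sup>2 * c ^ p)) = root p ((real p + 2)\<^sup>2) * c"
          using elim c0 by (simp add: real_root_mult norm_mult norm_power real_root_power_cancel)
        also have "root p ((real p + 2)\<^sup>2) = ((real p + 2) powr 2) powr (1 / real p)"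
          using elim by (simp add: root_powr_inverse powr_numeral)
        also have "\<dots> = (real p + 2) powr (2 / real p)" by (subst powr_powr) simp
        finally show ?case by simp
      qed
    qed
    show "1 * c < 1" using c by simp
  qed
  \<comment> \<open>One factor b_m has been split off and the index shifted by one, hence (p + 2)^2
    beside c^p.\<close>
  define D where "D = (\<Sum>p. K * ((real p + 2)\<^sup>2 * c ^ p))"
  have D0: "D \<ge> 0" unfolding D_def using c0 K by (intro suminf_nonneg sumC) simp
  have W0: "W m p \<ge> 0" for m p using b K by (simp add: W_def)
  have WSuc: "W m (Suc p) \<le> b m * (K * ((real p + 2)\<^sup>2 * c ^ p))" for m p
  proof -
    have "W m (Suc p) = b m * (K * ((real p + 2)\<^sup>2 * b m ^ p))" by (simp add: W_def algebra_simps)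
    also have "\<dots> \<le> b m * (K * ((real p + 2)\<^sup>2 * c ^ p))"
      using b K by (intro mult_left_mono power_mono) auto
    finally show ?thesis .
  qed
  have sumS: "summable (\<lambda>p. W m (Suc p))" for m
    by (rule summable_comparison_test'[OF summable_mult[OF sumC, of "b m"], of 0])
       (use WSuc W0 in auto)
  have sumW: "summable (W m)" for m using sumS[of m] by (simp add: summable_Suc_iff)
  have Wle: "suminf (W m) \<le> exp (D * b m)" for m
  proof -
    have "suminf (W m) = 1 + (\<Sum>p. W m (Suc p))"
      using suminf_split_head[OF sumW[of m]] by (simp add: W_def)
    also have "(\<Sum>p. W m (Suc p)) \<le> (\<Sum>p. b m * (K * ((real p + 2)\<^sup>2 * c ^ p)))"
      by (intro suminf_le WSuc sumS summable_mult sumC)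
    also have "\<dots> = D * b m" unfolding D_def by (subst suminf_mult[OF sumC]) simp
    also have "1 + D * b m \<le> exp (D * b m)" by (rule exp_ge_add_one_self)
    finally show ?thesis by simp
  qed
  show "exp (D * suminf b) \<ge> 1" using D0 b by (simp add: suminf_nonneg)
  fix F :: "(nat \<Rightarrow> nat) set" assume F: "finite F" "\<And>\<alpha>. \<alpha> \<in> F \<Longrightarrow> finite (supp \<alpha>)"
  define X where "X = (\<Union>\<alpha>\<in>F. supp \<alpha>)"
  have X: "finite X" "\<And>\<alpha>. \<alpha> \<in> F \<Longrightarrow> supp \<alpha> \<subseteq> X" using F by (auto simp: X_def)
  have "(\<Sum>\<alpha>\<in>F. \<Prod>m\<in>supp \<alpha>. K * (real (\<alpha> m) + 1)\<^sup>2 * b m ^ \<alpha> m) = (\<Sum>\<alpha>\<in>F. \<Prod>m\<in>X. W m (\<alpha> m))"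
  proof (rule sum.cong[OF refl])
    fix \<alpha> assume "\<alpha> \<in> F"
    then show "(\<Prod>m\<in>supp \<alpha>. K * (real (\<alpha> m) + 1)\<^sup>2 * b m ^ \<alpha> m) = (\<Prod>m\<in>X. W m (\<alpha> m))"
      using X by (intro prod.mono_neutral_cong_left) (auto simp: W_def supp_def)
  qed
  also have "\<dots> \<le> (\<Prod>m\<in>X. suminf (W m))"
    using X F W0 sumW by (intro sum_prod_weights_le) auto
  also have "\<dots> \<le> (\<Prod>m\<in>X. exp (D * b m))"
    using Wle by (intro prod_mono conjI suminf_nonneg sumW W0)
  also have "\<dots> = exp (D * (\<Sum>m\<in>X. b m))" using X by (simp add: exp_sum sum_distrib_left)
  also have "\<dots> \<le> exp (D * suminf b)"
    using D0 X b by (simp add: mult_left_mono sum_le_suminf)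
  finally show "(\<Sum>\<alpha>\<in>F. \<Prod>m\<in>supp \<alpha>. K * (real (\<alpha> m) + 1)\<^sup>2 * b m ^ \<alpha> m) \<le> exp (D * suminf b)" .
qed

lemma inverse_rho_le_1: "\<tau> m > 0 \<Longrightarrow> inverse (rho \<tau> m) \<le> 1"
  using rho_gt_1[of \<tau> m] by (simp add: inverse_le_1_iff)

context
  fixes \<tau> :: "nat \<Rightarrow> real"
  assumes \<tau>: "\<And>m. \<tau> m > 0"
begin

lemma bdd_above_inverse_rho: "bdd_above ((\<lambda>n. inverse (rho \<tau> n)) ` A)"
  using inverse_rho_le_1[of \<tau>] \<tau> by (intro bdd_aboveI2[where M=1]) auto

lemma eta_ge_inverse_rho: "inverse (rho \<tau> m) \<le> eta \<tau> m"
  unfolding eta_def by (intro cSUP_upper bdd_above_inverse_rho) auto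

lemma eta_pos: "eta \<tau> m > 0"
  using eta_ge_inverse_rho[of m] rho_gt_1[of \<tau> m, OF \<tau>]
  by (smt (verit) positive_imp_inverse_positive)

lemma eta_le_eta_0: "eta \<tau> m \<le> eta \<tau> 0"
  unfolding eta_def by (intro cSUP_subset_mono bdd_above_inverse_rho) auto

text \<open>A supremum of numbers below 1 could still be 1. Since \<tau> tends to infinity, all but
  finitely many of them are at most 1/2, and the rest has a maximum below 1.\<close>

lemma eta_0_less_1:
  assumes "filterlim \<tau> at_top sequentially"
  shows "eta \<tau> 0 < 1"
proof -
  obtain N where N: "\<And>n. n \<ge> N \<Longrightarrow> \<tau> n \<ge> 2"
    using assms by (auto simp: filterlim_at_top eventually_at_top_linorder)
  define B where "B = Max (insert (1/2) ((\<lambda>n. inverse (rho \<tau> n)) ` {..<N}))"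
  have "B < 1" unfolding B_def using rho_gt_1[OF \<tau>]
    by (subst Max_less_iff) (auto simp: inverse_less_1_iff)
  moreover have "inverse (rho \<tau> n) \<le> B" for n
  proof (cases "n < N")
    case True
    then show ?thesis unfolding B_def by (intro Max_ge) auto
  next
    case False
    then have "2 \<le> \<tau> n" using N by simp
    moreover have "sqrt (1 + (\<tau> n)\<^sup>2) \<ge> 0" by simp
    ultimately have "rho \<tau> n \<ge> 2" unfolding rho_def by linarith
    then have "inverse (rho \<tau> n) \<le> 1/2" using le_imp_inverse_le[of 2 "rho \<tau> n"] by simp
    also have "1/2 \<le> B" unfolding B_def by (intro Max_ge) auto
    finally show ?thesis .
  qed
  then have "eta \<tau> 0 \<le> B" unfolding eta_def by (intro cSUP_least) auto
  ultimately show ?thesis by simp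
qed

text \<open>The constant is uniform in m because R / (R - 1) = 1 / (1 - 1/R) and 1/R stays at most
  \<open>eta \<tau> 0\<close>. Level 0, where the bound is 1 without any constant, is left
  out.\<close>

lemma diff_bound_le_eta:
  assumes "eta \<tau> 0 < 1" "p > 0"
  shows "diff_bound (rho \<tau> m) p \<le> 12 / (1 - eta \<tau> 0) * (real p + 1)\<^sup>2 * eta \<tau> m ^ p"
proof -
  let ?R = "rho \<tau> m"
  have R: "?R > 1" by (rule rho_gt_1[OF \<tau>])
  have i: "1 / ?R \<le> eta \<tau> m" "eta \<tau> m \<le> eta \<tau> 0"
    using eta_ge_inverse_rho[of m] eta_le_eta_0 by (auto simp: inverse_eq_divide)
  have "?R / (?R - 1) = 1 / (1 - 1 / ?R)" using R by (simp add: field_simps)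
  also have "\<dots> \<le> 1 / (1 - eta \<tau> 0)"
    using i assms R by (intro divide_left_mono mult_pos_pos) auto
  finally have "12 * (?R / (?R - 1)) \<le> 12 / (1 - eta \<tau> 0)" by simp
  moreover have "(1 / ?R) ^ p \<le> eta \<tau> m ^ p" using i R by (intro power_mono) auto
  ultimately have "12 * (?R / (?R - 1)) * (real p + 1)\<^sup>2 * (1 / ?R) ^ p \<le>
      12 / (1 - eta \<tau> 0) * (real p + 1)\<^sup>2 * eta \<tau> m ^ p"
    using assms R by (intro mult_mono mult_nonneg_nonneg) auto
  then show ?thesis using assms by (simp add: diff_bound_def)
qed

end

section \<open>Summable weights and the number of points\<close>

lemma prod_powr:
  fixes f :: "'a \<Rightarrow> real"
  assumes "\<And>x. x \<in> A \<Longrightarrow> f x \<ge> 0"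
  shows "(\<Prod>x\<in>A. f x) powr q = (\<Prod>x\<in>A. f x powr q)"
  using assms
proof (induction A rule: infinite_finite_induct)
  case (insert x A)
  then show ?case by (simp add: powr_mult prod_nonneg)
qed auto

definition index_weight :: "real \<Rightarrow> (nat \<Rightarrow> nat) \<Rightarrow> real" where
  "index_weight K \<alpha> = (\<Prod>m\<in>supp \<alpha>. K * (real (\<alpha> m) + 1)\<^sup>2)"

text \<open>Formulated with finite partial sums, so that it can be used before the index set is
  known to be finite, and again for the tail of the expansion.\<close>

definition weights_summable :: "(nat \<Rightarrow> real) \<Rightarrow> real \<Rightarrow> real \<Rightarrow> real \<Rightarrow> bool" where
  "weights_summable \<eta> q K S \<longleftrightarrow> (\<forall>F. finite F \<and> (\<forall>\<alpha>\<in>F. finite (supp \<alpha>)) \<longrightarrow>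
     (\<Sum>\<alpha>\<in>F. index_weight K \<alpha> * multi_power \<eta> \<alpha> powr q) \<le> S)"

lemma weights_summable_ex:
  assumes \<eta>: "\<And>m. \<eta> m > 0" "\<And>m. \<eta> m \<le> c" "c < 1" and q: "q > 0" and sm: "summable (\<lambda>m. \<eta> m powr q)"
    and K: "K \<ge> 0"
  obtains S where "S \<ge> 1" "weights_summable \<eta> q K S"
proof -
  have "c > 0" using \<eta>(1,2)[of 0] by simp
  then have cq: "c powr q < 1" using \<eta>(3) q powr_less_mono2[of q c 1] by simp
  have le: "\<eta> m powr q \<le> c powr q" for m
    using \<eta>(1)[of m] \<eta>(2)[of m] q by (intro powr_mono2) auto
  obtain S where S: "S \<ge> 1" "\<And>F. finite F \<Longrightarrow> (\<And>\<alpha>. \<alpha> \<in> F \<Longrightarrow> finite (supp \<alpha>)) \<Longrightarrow>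
    (\<Sum>\<alpha>\<in>F. \<Prod>m\<in>supp \<alpha>. K * (real (\<alpha> m) + 1)\<^sup>2 * (\<eta> m powr q) ^ \<alpha> m) \<le> S"
    by (rule weighted_index_sum[OF sm _ le cq K]) auto
  have eq: "index_weight K \<alpha> * multi_power \<eta> \<alpha> powr q =
      (\<Prod>m\<in>supp \<alpha>. K * (real (\<alpha> m) + 1)\<^sup>2 * (\<eta> m powr q) ^ \<alpha> m)" for \<alpha>
  proof -
    have "(\<eta> m ^ k) powr q = (\<eta> m powr q) ^ k" for m k
      using \<eta>(1)[of m] by (simp add: powr_realpow[symmetric] powr_powr mult.commute)
    then show ?thesis using \<eta>(1)
      by (simp add: index_weight_def multi_power_def prod_powr less_imp_le prod.distrib)
  qed
  have "weights_summable \<eta> q K S" unfolding weights_summable_def eq using S(2) by blast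
  with S(1) that show ?thesis by blast
qed

lemma index_weight_ge:
  assumes "K \<ge> 1"
  shows "real (\<Prod>m\<in>supp \<alpha>. \<alpha> m + 1) \<le> index_weight K \<alpha>"
  unfolding index_weight_def of_nat_prod
proof (rule prod_mono, intro conjI)
  fix m
  have "1 * (real (\<alpha> m) + 1) \<le> K * ((real (\<alpha> m) + 1) * (real (\<alpha> m) + 1))"
    using assms by (intro mult_mono) auto
  then show "real (\<alpha> m + 1) \<le> K * (real (\<alpha> m) + 1)\<^sup>2" by (simp add: power2_eq_square add.commute)
qed simp

lemma multi_power_pos: "(\<And>m. \<eta> m > 0) \<Longrightarrow> multi_power \<eta> \<alpha> > 0"
  unfolding multi_power_def by (intro prod_pos) simp

text \<open>A Markov-type estimate: on the index set \<eta>^\<alpha> / \<epsilon> \<ge> 1, so each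
  index may be weighted with the q-th power of this ratio. It is stated for finite subsets because
  finiteness of the index set is deduced from it.\<close>

lemma num_points_partial:
  assumes ws: "weights_summable \<eta> q K S" and K: "K \<ge> 1" and q: "q > 0" and \<epsilon>: "\<epsilon> > 0"
    and F: "finite F" "F \<subseteq> index_set \<eta> \<epsilon>"
  shows "real (num_points F) \<le> S * \<epsilon> powr - q"
proof -
  have "real (num_points F) \<le> (\<Sum>\<alpha>\<in>F. index_weight K \<alpha> * multi_power \<eta> \<alpha> powr q * \<epsilon> powr - q)"
    unfolding num_points_def of_nat_sum
  proof (rule sum_mono)
    fix \<alpha> assume "\<alpha> \<in> F"
    then have "\<epsilon> \<le> multi_power \<eta> \<alpha>" using F by (auto simp: index_set_def)
    then have "\<epsilon> powr q * \<epsilon> powr - q \<le> multi_power \<eta> \<alpha> powr q * \<epsilon> powr - q"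
      using q \<epsilon> by (intro mult_right_mono powr_mono2) auto
    then have 1: "1 \<le> multi_power \<eta> \<alpha> powr q * \<epsilon> powr - q"
      using \<epsilon> by (simp flip: powr_add)
    have "real (\<Prod>m\<in>supp \<alpha>. \<alpha> m + 1) * 1 \<le> index_weight K \<alpha> * (multi_power \<eta> \<alpha> powr q * \<epsilon> powr - q)"
      using index_weight_ge[OF K, of \<alpha>] 1 order.trans[OF of_nat_0_le_iff index_weight_ge[OF K]]
      by (intro mult_mono) auto
    then show "real (\<Prod>m\<in>supp \<alpha>. \<alpha> m + 1) \<le> index_weight K \<alpha> * multi_power \<eta> \<alpha> powr q * \<epsilon> powr - q"
      by (simp only: mult_1_right mult.assoc)
  qed
  also have "\<dots> \<le> S * \<epsilon> powr - q"
    unfolding sum_distrib_right[symmetric]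
    using ws F by (intro mult_right_mono) (auto simp: weights_summable_def index_set_def)
  finally show ?thesis .
qed

lemma card_le_num_points: "card F \<le> num_points F"
proof -
  have "(\<Sum>\<alpha>\<in>F. 1) \<le> (\<Sum>\<alpha>\<in>F. \<Prod>m\<in>supp \<alpha>. \<alpha> m + 1)" by (intro sum_mono prod_ge_1) auto
  then show ?thesis by (simp add: num_points_def)
qed

lemma finite_index_set:
  assumes ws: "weights_summable \<eta> q K S" and K: "K \<ge> 1" and q: "q > 0" and \<epsilon>: "\<epsilon> > 0"
  shows "finite (index_set \<eta> \<epsilon>)"
proof (rule ccontr)
  assume inf: "infinite (index_set \<eta> \<epsilon>)"
  obtain F where F: "finite F" "F \<subseteq> index_set \<eta> \<epsilon>" "card F = nat \<lceil>S * \<epsilon> powr - q\<rceil> + 1"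
    using infinite_arbitrarily_large[OF inf] by blast
  then have "real (card F) > S * \<epsilon> powr - q" by linarith
  moreover have "real (card F) \<le> real (num_points F)" using card_le_num_points[of F] by simp
  ultimately show False using num_points_partial[OF ws K q \<epsilon> F(1,2)] by linarith
qed

lemma num_points_ge_1:
  assumes "finite (index_set \<eta> \<epsilon>)" "\<epsilon> \<le> 1"
  shows "num_points (index_set \<eta> \<epsilon>) \<ge> 1"
proof -
  have "(\<lambda>_. 0) \<in> index_set \<eta> \<epsilon>" using assms by (simp add: index_set_def supp_def multi_power_def)
  then have "card (index_set \<eta> \<epsilon>) > 0" using assms(1) by (auto simp: card_gt_0_iff)
  then show ?thesis using card_le_num_points[of "index_set \<eta> \<epsilon>"] by simp
qed

section \<open>The collocation error\<close>

text \<open>Rankin's trick for the tail: one part of the power is kept for summability, the other is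
  traded for the threshold.\<close>

lemma multi_power_tail:
  assumes "multi_power \<eta> \<alpha> < \<epsilon>" "multi_power \<eta> \<alpha> > 0" "q \<le> 1"
  shows "multi_power \<eta> \<alpha> \<le> multi_power \<eta> \<alpha> powr q * \<epsilon> powr (1 - q)"
proof -
  have "multi_power \<eta> \<alpha> = multi_power \<eta> \<alpha> powr q * multi_power \<eta> \<alpha> powr (1 - q)"
    using assms by (simp flip: powr_add)
  also have "\<dots> \<le> multi_power \<eta> \<alpha> powr q * \<epsilon> powr (1 - q)"
    using assms by (intro mult_left_mono powr_mono2) auto
  finally show ?thesis .
qed

text \<open>For n variables, the expansion over all supported indices minus the finite sum over the
  index set leaves the indices with \<eta>^\<alpha> < \<epsilon>. All finite partial sums of this
  remainder obey the bound, hence so does its limit.\<close>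

lemma tens_error:
  fixes g :: "(nat \<Rightarrow> real) \<Rightarrow> complex"
  assumes adm: "adm \<tau> {..<n} M g" and \<tau>: "\<And>m. \<tau> m > 0" and M: "M \<ge> 0" and y: "y \<in> Gam"
    and \<eta>: "\<And>m. \<eta> m > 0"
    and db: "\<And>m p. p > 0 \<Longrightarrow> diff_bound (rho \<tau> m) p \<le> K * (real p + 1)\<^sup>2 * \<eta> m ^ p"
    and ws: "weights_summable \<eta> q K S" and q: "q \<le> 1"
    and A: "finite (index_set \<eta> \<epsilon>)" "\<And>\<alpha>. \<alpha> \<in> index_set \<eta> \<epsilon> \<Longrightarrow> supp \<alpha> \<subseteq> {..<n}"
  shows "norm (g y - (\<Sum>\<alpha>\<in>index_set \<eta> \<epsilon>. tens [0..<n] \<alpha> g y)) \<le> M * (S * \<epsilon> powr (1 - q))"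
proof -
  let ?A = "index_set \<eta> \<epsilon>" and ?B = "{\<alpha>. supp \<alpha> \<subseteq> {..<n}}"
  have "((\<lambda>\<alpha>. tens [0..<n] \<alpha> g y) has_sum g y) ?B"
    using tens_has_sum[OF adm \<tau> _ _ y, of "[0..<n]"] by (simp add: atLeast0LessThan)
  moreover have "((\<lambda>\<alpha>. tens [0..<n] \<alpha> g y) has_sum (\<Sum>\<alpha>\<in>?A. tens [0..<n] \<alpha> g y)) ?A"
    using A(1) by simp
  ultimately have "((\<lambda>\<alpha>. tens [0..<n] \<alpha> g y) has_sum (g y - (\<Sum>\<alpha>\<in>?A. tens [0..<n] \<alpha> g y))) (?B - ?A)"
    by (rule has_sum_Diff) (use A(2) in auto)
  then have lim: "(sum (\<lambda>\<alpha>. tens [0..<n] \<alpha> g y) \<longlongrightarrow> g y - (\<Sum>\<alpha>\<in>?A. tens [0..<n] \<alpha> g y))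
      (finite_subsets_at_top (?B - ?A))"
    by (simp add: has_sum_def)
  have bound: "norm (\<Sum>\<alpha>\<in>F. tens [0..<n] \<alpha> g y) \<le> M * (S * \<epsilon> powr (1 - q))"
    if F: "finite F" "F \<subseteq> ?B - ?A" for F
  proof -
    have "norm (tens [0..<n] \<alpha> g y) \<le> M * (index_weight K \<alpha> * multi_power \<eta> \<alpha> powr q * \<epsilon> powr (1 - q))"
      if \<alpha>: "\<alpha> \<in> F" for \<alpha>
    proof -
      have s: "supp \<alpha> \<subseteq> {..<n}" using F \<alpha> by auto
      then have fs: "finite (supp \<alpha>)" using finite_subset by blast
      then have small: "multi_power \<eta> \<alpha> < \<epsilon>" using F \<alpha> by (auto simp: index_set_def)
      have "norm (tens [0..<n] \<alpha> g y) \<le> M * (\<Prod>m\<in>set [0..<n]. diff_bound (rho \<tau> m) (\<alpha> m))"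
        by (rule norm_tens_le[OF adm _ _ \<tau> y]) auto
      also have "(\<Prod>m\<in>set [0..<n]. diff_bound (rho \<tau> m) (\<alpha> m)) = (\<Prod>m\<in>supp \<alpha>. diff_bound (rho \<tau> m) (\<alpha> m))"
        using s by (intro prod.mono_neutral_right) (auto simp: supp_def diff_bound_def)
      also have "\<dots> \<le> (\<Prod>m\<in>supp \<alpha>. K * (real (\<alpha> m) + 1)\<^sup>2 * \<eta> m ^ \<alpha> m)"
        by (intro prod_mono conjI diff_bound_nonneg rho_gt_1 \<tau> db) (auto simp: supp_def)
      also have "\<dots> = index_weight K \<alpha> * multi_power \<eta> \<alpha>"
        by (simp add: index_weight_def multi_power_def prod.distrib)
      also have "\<dots> \<le> index_weight K \<alpha> * (multi_power \<eta> \<alpha> powr q * \<epsilon> powr (1 - q))"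
      proof (intro mult_left_mono multi_power_tail[OF small multi_power_pos[OF \<eta>] q])
        have "0 \<le> diff_bound (rho \<tau> 0) 1" by (intro diff_bound_nonneg rho_gt_1 \<tau>)
        also have "\<dots> \<le> K * (real 1 + 1)\<^sup>2 * \<eta> 0 ^ 1" by (rule db) simp
        finally have "K \<ge> 0" using \<eta>[of 0] by (simp add: zero_le_mult_iff)
        then show "index_weight K \<alpha> \<ge> 0" by (auto simp: index_weight_def intro!: prod_nonneg)
      qed
      finally show ?thesis using M by (simp add: mult.assoc mult_left_mono)
    qed
    then have "norm (\<Sum>\<alpha>\<in>F. tens [0..<n] \<alpha> g y) \<le>
        (\<Sum>\<alpha>\<in>F. M * (index_weight K \<alpha> * multi_power \<eta> \<alpha> powr q * \<epsilon> powr (1 - q)))"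
      by (rule sum_norm_le)
    also have "\<dots> = M * ((\<Sum>\<alpha>\<in>F. index_weight K \<alpha> * multi_power \<eta> \<alpha> powr q) * \<epsilon> powr (1 - q))"
      by (simp add: sum_distrib_left sum_distrib_right)
    also have "\<dots> \<le> M * (S * \<epsilon> powr (1 - q))"
    proof (intro mult_left_mono mult_right_mono M)
      have "finite (supp \<alpha>)" if "\<alpha> \<in> F" for \<alpha>
        using F(2) that finite_subset[of "supp \<alpha>" "{..<n}"] by auto
      then show "(\<Sum>\<alpha>\<in>F. index_weight K \<alpha> * multi_power \<eta> \<alpha> powr q) \<le> S"
        using ws F(1) unfolding weights_summable_def by blast
    qed simp
    finally show ?thesis .
  qed
  show ?thesis
    by (rule tendsto_upperbound[OF tendsto_norm[OF lim]])
       (auto intro!: eventually_finite_subsets_at_top_weakI bound)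
qed

definition trunc :: "nat \<Rightarrow> (nat \<Rightarrow> 'a::zero) \<Rightarrow> nat \<Rightarrow> 'a" where
  "trunc n y = (\<lambda>m. if m < n then y m else 0)"

text \<open>For n beyond all supports in the finite index set the collocation sum no longer sees the
  truncation, and the bound for the truncated function does not depend on n; so n tends to infinity
  with the collocation term fixed.\<close>

lemma collocation_error_scalar:
  fixes h :: "(nat \<Rightarrow> real) \<Rightarrow> complex"
  assumes adm: "\<And>n. adm \<tau> {..<n} M (\<lambda>y. h (trunc n y))"
    and lim: "(\<lambda>n. h (trunc n y)) \<longlonglongrightarrow> h y"
    and \<tau>: "\<And>m. \<tau> m > 0" and M: "M \<ge> 0" and y: "y \<in> Gam"
    and \<eta>: "\<And>m. \<eta> m > 0"
    and db: "\<And>m p. p > 0 \<Longrightarrow> diff_bound (rho \<tau> m) p \<le> K * (real p + 1)\<^sup>2 * \<eta> m ^ p"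
    and ws: "weights_summable \<eta> q K S" and q: "q \<le> 1"
    and A: "finite (index_set \<eta> \<epsilon>)"
  shows "norm (h y - collocation (index_set \<eta> \<epsilon>) h y) \<le> M * (S * \<epsilon> powr (1 - q))"
proof -
  have "finite (\<Union>\<alpha>\<in>index_set \<eta> \<epsilon>. supp \<alpha>)" using A by (auto simp: index_set_def)
  then obtain N where N: "(\<Union>\<alpha>\<in>index_set \<eta> \<epsilon>. supp \<alpha>) \<subseteq> {..<N}"
    using finite_nat_iff_bounded by blast
  have "norm (h (trunc n y) - collocation (index_set \<eta> \<epsilon>) h y) \<le> M * (S * \<epsilon> powr (1 - q))" if n: "n \<ge> N" for n
  proof -
    have s: "supp \<alpha> \<subseteq> {..<n}" if "\<alpha> \<in> index_set \<eta> \<epsilon>" for \<alpha>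
      using that N n by fastforce
    have "collocation (index_set \<eta> \<epsilon>) h y = (\<Sum>\<alpha>\<in>index_set \<eta> \<epsilon>. tens [0..<n] \<alpha> (\<lambda>y. h (trunc n y)) y)"
      unfolding collocation_def
      by (intro sum.cong refl) (simp add: tensor_diff_tens[OF s] trunc_def)
    then show ?thesis using tens_error[OF adm \<tau> M y \<eta> db ws q A s] by simp
  qed
  then show ?thesis
    by (intro tendsto_upperbound[OF tendsto_norm[OF tendsto_diff[OF lim tendsto_const]]])
       (auto simp: eventually_at_top_linorder)
qed

section \<open>Square integrability of continuous functions on the cube\<close>

text \<open>A continuous retraction of the whole sequence space onto the cube. Composing with it
  extends a function continuous on \<open>Gam\<close> to one continuous everywhere, to which the
  Borel measurability of continuous functions applies.\<close>

definition clamp1 :: "(nat \<Rightarrow> real) \<Rightarrow> nat \<Rightarrow> real" where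
  "clamp1 y = (\<lambda>m. max (- 1) (min 1 (y m)))"

lemma clamp1_in_Gam: "clamp1 y \<in> Gam"
  by (auto simp: clamp1_def Gam_def)

lemma clamp1_id: "y \<in> Gam \<Longrightarrow> clamp1 y = y"
  by (auto simp: clamp1_def Gam_def fun_eq_iff)

lemma continuous_clamp1: "continuous_on UNIV clamp1"
  unfolding clamp1_def
  by (intro continuous_on_coordinatewise_then_product continuous_intros continuous_on_product_coordinates)

lemma prob_space_unif: "prob_space unif"
  unfolding unif_def
proof (rule prob_space_PiM)
  show "prob_space (density (restrict_space lborel {-1..1::real}) (\<lambda>_. 1 / 2))"
  proof (rule prob_spaceI)
    have "emeasure (density (restrict_space lborel {-1..1::real}) (\<lambda>_. 1 / 2)) {-1..1} =
      1 / 2 * emeasure (restrict_space lborel {-1..1::real}) {-1..1}"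
      by (subst emeasure_density_const) (auto simp: sets_restrict_space)
    also have "emeasure (restrict_space lborel {-1..1::real}) {-1..1} = 2"
      by (subst emeasure_restrict_space) auto
    also have "(1 / 2 :: ennreal) * 2 = 1"
      by (simp add: ennreal_divide_times)
    finally show "emeasure (density (restrict_space lborel {-1..1::real}) (\<lambda>_. 1 / 2))
        (space (density (restrict_space lborel {-1..1::real}) (\<lambda>_. 1 / 2))) = 1"
      by (simp add: space_restrict_space)
  qed
qed

text \<open>\<open>unif\<close> is a product of restricted measures, while continuous functions are
  measurable for the Borel sets of the product topology. On a countable product of real lines these
  Borel sets are generated by the coordinates.\<close>

lemma measurable_unif_borel: "(\<lambda>y. y) \<in> measurable unif (borel :: (nat \<Rightarrow> real) measure)"
proof -
  have "(\<lambda>y. y m) \<in> borel_measurable unif" for m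
  proof -
    have "(\<lambda>y. y m) \<in> measurable unif (density (restrict_space lborel {-1..1}) (\<lambda>_. 1 / 2))"
      unfolding unif_def by (rule measurable_component_singleton) simp
    moreover have "(\<lambda>x. x) \<in> measurable (density (restrict_space lborel {-1..1}) (\<lambda>_. 1 / 2)) (borel :: real measure)"
      by (simp add: measurable_restrict_space1)
    ultimately show ?thesis by (rule measurable_compose)
  qed
  then have "(\<lambda>y. y) \<in> measurable unif (PiM UNIV (\<lambda>_. borel :: real measure))"
    by (intro measurable_PiM_single') auto
  then show ?thesis using sets_PiM_equal_borel measurable_cong_sets by blast
qed

lemma bochner_L2_continuous:
  fixes f :: "(nat \<Rightarrow> real) \<Rightarrow> 'h::real_normed_vector"
  assumes f: "continuous_on Gam f" and B: "\<And>y. y \<in> Gam \<Longrightarrow> norm (f y) \<le> B"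
  shows "f \<in> bochner_L2 unif" "L2_norm unif f \<le> B"
proof -
  interpret prob_space unif by (rule prob_space_unif)
  define g where "g y = f (clamp1 y)" for y
  have g: "continuous_on UNIV g"
    unfolding g_def
    by (rule continuous_on_compose2[OF f continuous_clamp1]) (auto simp: clamp1_in_Gam)
  have fg: "f y = g y" if "y \<in> Gam" for y using that by (simp add: g_def clamp1_id)
  have "g \<in> borel_measurable unif"
    using measurable_compose[OF measurable_unif_borel borel_measurable_continuous_onI[OF g]] .
  then have mf: "f \<in> borel_measurable unif"
    using measurable_cong[of unif f g borel] fg by (simp add: space_unif)
  have B0: "B \<ge> 0" using B[OF clamp1_in_Gam] norm_ge_zero order.trans by blast
  obtain D :: "(nat \<Rightarrow> real) set" where D: "countable D"
      "\<And>X. open X \<Longrightarrow> X \<noteq> {} \<Longrightarrow> \<exists>d\<in>D. d \<in> X"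
    using countable_dense_setE by blast
  have cD: "closure D = UNIV"
    using D(2)[of "- closure D"] closure_subset[of D] by (auto simp: open_Compl)
  \<comment> \<open>Strong measurability: the image of a countable dense set of sequences is
    countable, and by continuity its closure contains all values.\<close>
  have sep: "AE y in unif. f y \<in> closure (g ` D)"
  proof (rule AE_I2)
    fix y assume "y \<in> space unif"
    moreover have "g ` closure D \<subseteq> closure (g ` D)"
      by (rule image_closure_subset) (auto intro: continuous_on_subset[OF g] closure_subset[THEN subsetD])
    ultimately show "f y \<in> closure (g ` D)" using fg cD by (auto simp: space_unif)
  qed
  have sq: "norm ((norm (f y))\<^sup>2) \<le> B\<^sup>2" if "y \<in> Gam" for y
    using B[OF that] by (simp add: power_mono)
  have int: "integrable unif (\<lambda>y. (norm (f y))\<^sup>2)"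
  proof (rule integrable_const_bound[of _ "B\<^sup>2"])
    show "(\<lambda>y. (norm (f y))\<^sup>2) \<in> borel_measurable unif" using mf by measurable
  qed (use sq in \<open>auto simp: space_unif intro!: AE_I2\<close>)
  show "f \<in> bochner_L2 unif"
    unfolding bochner_L2_def
    using mf sep int countable_image[OF D(1), of g] by (intro CollectI conjI exI[of _ "g ` D"])
  have "(\<integral>y. (norm (f y))\<^sup>2 \<partial>unif) \<le> (\<integral>y. B\<^sup>2 \<partial>unif)"
    using sq int by (intro integral_mono) (auto simp: space_unif)
  also have "\<dots> = B\<^sup>2" by (simp add: prob_space)
  finally show "L2_norm unif f \<le> B"
    unfolding L2_norm_def using B0 by (intro real_le_lsqrt)
qed

lemma continuous_on_interp_diff:
  fixes g :: "(nat \<Rightarrow> real) \<Rightarrow> 'h::real_normed_vector"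
  assumes "continuous_on Gam g"
  shows "continuous_on Gam (in_variable m (interp_diff p) g)"
proof -
  have coord: "continuous_on Gam (\<lambda>y. y k)" for k :: nat
    by (rule continuous_on_subset[OF continuous_on_product_coordinates]) simp
  have c: "continuous_on Gam (\<lambda>y. interp q (\<lambda>t. g (y(m := t))) (y m))" for q
    unfolding interp_eq
  proof (intro continuous_on_sum continuous_on_scaleR)
    fix x assume x: "x \<in> nodes q"
    show "continuous_on Gam (\<lambda>y. poly (lag q x) (y m))"
      by (intro continuous_on_poly coord)
    have "continuous_on Gam (\<lambda>y. y(m := x))"
    proof (rule continuous_on_coordinatewise_then_product)
      show "continuous_on Gam (\<lambda>y. (y(m := x)) k)" for k
        by (cases "k = m") (auto intro: coord)
    qed
    then show "continuous_on Gam (\<lambda>y. g (y(m := x)))"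
      using nodes_subset[of q] x by (intro continuous_on_compose2[OF assms]) (auto intro!: Gam_upd)
  qed
  show ?thesis
    unfolding in_variable_def interp_diff_def
    by (cases "p = 0") (auto intro!: continuous_on_diff c)
qed

lemma continuous_on_tens:
  fixes g :: "(nat \<Rightarrow> real) \<Rightarrow> 'h::real_normed_vector"
  assumes "continuous_on Gam g"
  shows "continuous_on Gam (tens xs \<alpha> g)"
  using assms
  by (induction xs arbitrary: g rule: rev_induct) (auto simp: tens_snoc continuous_on_interp_diff, simp add: tens_def)

lemma continuous_on_collocation:
  fixes v :: "(nat \<Rightarrow> real) \<Rightarrow> 'h::real_normed_vector"
  assumes v: "continuous_on Gam v" and A: "\<And>\<alpha>. \<alpha> \<in> A \<Longrightarrow> finite (supp \<alpha>)"
  shows "continuous_on Gam (\<lambda>y. collocation A v y)"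
  unfolding collocation_def
proof (rule continuous_on_sum)
  fix \<alpha> assume "\<alpha> \<in> A"
  obtain n where n: "supp \<alpha> \<subseteq> {..<n}"
    using A[OF \<open>\<alpha> \<in> A\<close>] finite_nat_iff_bounded by blast
  have "continuous_on Gam (\<lambda>y. v (\<lambda>m. if m < n then y m else 0))"
  proof (rule continuous_on_compose2[OF v])
    show "continuous_on Gam (\<lambda>y m. if m < n then y m else (0::real))"
    proof (rule continuous_on_coordinatewise_then_product)
      show "continuous_on Gam (\<lambda>y. if m < n then y m else (0::real))" for m
        by (cases "m < n") (auto intro: continuous_on_subset[OF continuous_on_product_coordinates])
    qed
  qed (auto simp: Gam_def)
  then show "continuous_on Gam (tensor_diff \<alpha> v)"
    unfolding tensor_diff_tens[OF n] by (rule continuous_on_tens)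
qed

section \<open>Scalarisation and the convergence rate\<close>

context complex_hilbert
begin

lemma cinner_scaleR_left: "cinner (r *\<^sub>R x) y = of_real r * cinner x y"
  by (metis scaleC_of_real cinner_scaleC_left)

text \<open>\<open>complex_hilbert\<close> ties the two inner products together only through the
  norm, so the identity comes from polarisation.\<close>

lemma Re_cinner: "Re (cinner x y) = x \<bullet> y"
proof -
  have add_right: "cinner z (x + y) = cinner z x + cinner z y" for z
    using cinner_commute[of z "x + y"] cinner_commute[of z x] cinner_commute[of z y]
    by (metis cinner_add_left cinner_commute complex_cnj_add)
  have "cinner (x + y) (x + y) = cinner x x + cinner y y + (cinner x y + cnj (cinner x y))"
    by (simp add: cinner_add_left add_right cinner_commute[of y x])
  then have "of_real ((norm (x + y))\<^sup>2) = of_real ((norm x)\<^sup>2) + of_real ((norm y)\<^sup>2) + complex_of_real (2 * Re (cinner x y))"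
    by (simp only: cinner_self complex_add_cnj)
  then have "(norm (x + y))\<^sup>2 = (norm x)\<^sup>2 + (norm y)\<^sup>2 + 2 * Re (cinner x y)"
    by (metis of_real_add of_real_eq_iff)
  then show ?thesis by (simp add: dot_norm)
qed

lemma norm_scaleC: "norm (scaleC c x) = norm c * norm x"
proof -
  have "complex_of_real ((norm (scaleC c x))\<^sup>2) = c * cnj (c * cinner x x)"
    by (metis cinner_self cinner_scaleC_left cinner_commute)
  also have "\<dots> = complex_of_real ((norm c * norm x)\<^sup>2)"
    by (simp add: cinner_self power_mult_distrib flip: complex_norm_square)
  finally have "(norm (scaleC c x))\<^sup>2 = (norm c * norm x)\<^sup>2" by (simp only: of_real_eq_iff)
  then show ?thesis by (simp add: power2_eq_iff_nonneg)
qed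

text \<open>The real Cauchy-Schwarz inequality after rotating x by a unimodular scalar c that makes
  the Hermitian product real and nonnegative.\<close>

lemma norm_cinner_le: "norm (cinner x y) \<le> norm x * norm y"
proof (cases "cinner x y = 0")
  case False
  let ?a = "cinner x y"
  define c where "c = cnj ?a / of_real (norm ?a)"
  have nc: "norm c = 1" using False by (simp add: c_def norm_divide)
  have "cinner (scaleC c x) y = of_real (norm ?a)"
    using False by (simp add: cinner_scaleC_left c_def field_simps complex_norm_square[symmetric] power2_eq_square)
  then have "norm ?a = scaleC c x \<bullet> y" by (metis Re_cinner Re_complex_of_real)
  also have "\<dots> \<le> norm (scaleC c x) * norm y" by (rule norm_cauchy_schwarz)
  finally show ?thesis by (simp add: norm_scaleC nc)
qed simp

lemma cinner_diff_left: "cinner (x - y) z = cinner x z - cinner y z"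
  using cinner_add_left[of "x - y" y z] by simp

text \<open>With the singleton S = {m}, the vector-valued first-order expansion is paired with k,
  and \<open>norm_cinner_le\<close> turns its remainder estimate into complex
  differentiability.\<close>

lemma holomorphic_cinner_coordinate:
  assumes u: "finitely_holomorphic_on scaleC u U" and U: "\<And>t. t \<in> D \<Longrightarrow> z(m := t) \<in> U" and D: "open D"
  shows "(\<lambda>t. cinner (u (z(m := t))) k) holomorphic_on D"
proof -
  have "\<exists>d. ((\<lambda>t. cinner (u (z(m := t))) k) has_field_derivative d) (at t)" if t: "t \<in> D" for t
  proof -
    let ?z = "z(m := t)"
    have "\<exists>d. \<forall>e>0. \<exists>\<delta>>0. \<forall>h. (\<forall>j. j \<notin> {m} \<longrightarrow> h j = 0) \<and> (\<forall>j\<in>{m}. norm (h j) < \<delta>) \<longrightarrow>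
        norm (u (\<lambda>j. ?z j + h j) - u ?z - (\<Sum>j\<in>{m}. scaleC (h j) (d j))) \<le> e * (\<Sum>j\<in>{m}. norm (h j))"
      by (rule u[unfolded finitely_holomorphic_on_def, rule_format, OF U[OF t]]) simp
    then obtain d where d: "\<forall>e>0. \<exists>\<delta>>0. \<forall>h. (\<forall>j. j \<notin> {m} \<longrightarrow> h j = 0) \<and> (\<forall>j\<in>{m}. norm (h j) < \<delta>) \<longrightarrow>
        norm (u (\<lambda>j. ?z j + h j) - u ?z - (\<Sum>j\<in>{m}. scaleC (h j) (d j))) \<le> e * (\<Sum>j\<in>{m}. norm (h j))"
      by (elim exE)
    have "((\<lambda>t. cinner (u (z(m := t))) k) has_derivative (*) (cinner (d m) k)) (at t)"
      unfolding has_derivative_at_alt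
    proof (intro conjI allI impI bounded_linear_mult_right)
      fix e :: real assume e: "e > 0"
      define e' where "e' = e / (norm k + 1)"
      have e': "e' > 0" "e' * norm k \<le> e"
        using e by (auto simp: e'_def field_simps add_pos_nonneg) 
      obtain \<delta> where \<delta>: "\<delta> > 0" "\<And>h. (\<forall>j. j \<notin> {m} \<longrightarrow> h j = 0) \<Longrightarrow> norm (h m) < \<delta> \<Longrightarrow>
        norm (u (\<lambda>j. ?z j + h j) - u ?z - scaleC (h m) (d m)) \<le> e' * norm (h m)"
        using d[rule_format, OF e'(1)] by auto
      have "norm (cinner (u (z(m := s))) k - cinner (u ?z) k - cinner (d m) k * (s - t)) \<le> e * norm (s - t)"
        if s: "norm (s - t) < \<delta>" for s
      proof -
        let ?h = "\<lambda>j. if j = m then s - t else 0"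
        have zs: "(\<lambda>j. ?z j + ?h j) = z(m := s)" by auto
        have "norm (u (z(m := s)) - u ?z - scaleC (s - t) (d m)) \<le> e' * norm (s - t)"
          using \<delta>(2)[of ?h] s unfolding zs by simp
        then have "norm (u (z(m := s)) - u ?z - scaleC (s - t) (d m)) * norm k \<le> e' * norm (s - t) * norm k"
          by (rule mult_right_mono) simp
        also have "\<dots> = e' * norm k * norm (s - t)" by simp
        also have "\<dots> \<le> e * norm (s - t)" using e'(2) by (rule mult_right_mono) simp
        finally have "norm (u (z(m := s)) - u ?z - scaleC (s - t) (d m)) * norm k \<le> e * norm (s - t)" .
        with norm_cinner_le[of "u (z(m := s)) - u ?z - scaleC (s - t) (d m)" k]
        have "norm (cinner (u (z(m := s)) - u ?z - scaleC (s - t) (d m)) k) \<le> e * norm (s - t)"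
          by linarith
        then show ?thesis by (simp add: cinner_diff_left cinner_scaleC_left mult.commute)
      qed
      then show "\<exists>\<delta>>0. \<forall>s. norm (s - t) < \<delta> \<longrightarrow>
          norm (cinner (u (z(m := s))) k - cinner (u ?z) k - cinner (d m) k * (s - t)) \<le> e * norm (s - t)"
        using \<delta>(1) by blast
    qed
    then show ?thesis unfolding has_field_derivative_def by blast
  qed
  then show ?thesis using D by (simp add: holomorphic_on_open)
qed

end

lemma tendsto_fun_componentwise:
  fixes f :: "'c \<Rightarrow> 'a \<Rightarrow> 'b::topological_space"
  assumes "\<And>i. ((\<lambda>c. f c i) \<longlongrightarrow> l i) F"
  shows "(f \<longlongrightarrow> l) F"
proof -
  have "limitin (product_topology (\<lambda>_. euclidean) UNIV) f l F"
    using assms by (simp add: limitin_componentwise)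
  then show ?thesis by (simp add: euclidean_product_topology)
qed

lemma trunc_in_region:
  assumes "z \<in> part_region \<tau> {..<n}" "\<And>m. \<tau> m > 0"
  shows "trunc n z \<in> region \<tau>"
proof -
  have "trunc n z m \<in> strip (\<tau> m)" for m
  proof (cases "m < n")
    case True
    have "z m \<in> (if m \<in> {..<n} then strip (\<tau> m) else of_real ` {-1..1})"
      using assms(1) unfolding part_region_def by blast
    then show ?thesis using True by (simp add: trunc_def)
  next
    case False
    then show ?thesis using of_real_in_strip[OF assms(2)[of m], of 0] by (simp add: trunc_def)
  qed
  then show ?thesis by (simp add: region_def strip_def)
qed

lemma trunc_in_Gam: "y \<in> Gam \<Longrightarrow> trunc n y \<in> Gam"
  by (auto simp: trunc_def Gam_def)

lemma of_real_trunc: "(\<lambda>m. complex_of_real (trunc n y m)) = trunc n (\<lambda>m. of_real (y m))"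
  by (auto simp: trunc_def)

lemma Gam_region: "y \<in> Gam \<Longrightarrow> (\<And>m. \<tau> m > 0) \<Longrightarrow> (\<lambda>m. of_real (y m)) \<in> region \<tau>"
  using of_real_in_strip by (auto simp: region_def Gam_def strip_def)

context complex_hilbert
begin

lemma scalarised_adm:
  assumes ext: "analytic_extension scaleC \<iota> \<tau> v u" and M: "\<And>z. z \<in> region \<tau> \<Longrightarrow> norm (u z) \<le> M"
    and \<tau>: "\<And>m. \<tau> m > 0"
  shows "adm \<tau> {..<n} (M * norm k) (\<lambda>y. cinner (\<iota> (v (trunc n y))) k)"
  unfolding adm_def
proof (intro exI[of _ "\<lambda>z. cinner (u (trunc n z)) k"] conjI ballI)
  fix z assume z: "z \<in> part_region \<tau> {..<n}"
  have "norm (cinner (u (trunc n z)) k) \<le> norm (u (trunc n z)) * norm k" by (rule norm_cinner_le)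
  also have "\<dots> \<le> M * norm k" by (intro mult_right_mono M trunc_in_region z \<tau>) simp
  finally show "norm (cinner (u (trunc n z)) k) \<le> M * norm k" .
  fix m assume m: "m \<in> {..<n}"
  have eq: "trunc n (z(m := t)) = (trunc n z)(m := t)" for t using m by (auto simp: trunc_def)
  show "(\<lambda>t. cinner (u (trunc n (z(m := t)))) k) holomorphic_on strip (\<tau> m)"
    unfolding eq
  proof (rule holomorphic_cinner_coordinate[OF _ _ open_strip])
    show "finitely_holomorphic_on scaleC u (region \<tau>)" using ext by (simp add: analytic_extension_def)
    show "(trunc n z)(m := t) \<in> region \<tau>" if "t \<in> strip (\<tau> m)" for t
      using trunc_in_region[OF z \<tau>] that by (auto simp: region_def strip_def)
  qed
next
  fix y assume "y \<in> Gam"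
  then show "cinner (u (trunc n (\<lambda>m. of_real (y m)))) k = cinner (\<iota> (v (trunc n y))) k"
    using ext trunc_in_Gam[of y n] by (simp add: analytic_extension_def flip: of_real_trunc)
qed

text \<open>Truncations converge coordinatewise, hence in the product topology, and the extension is
  continuous there. This passage carries the finite-dimensional estimates to infinitely many
  variables.\<close>

lemma scalarised_limit:
  assumes ext: "analytic_extension scaleC \<iota> \<tau> v u" and \<tau>: "\<And>m. \<tau> m > 0" and y: "y \<in> Gam"
  shows "(\<lambda>n. cinner (\<iota> (v (trunc n y))) k) \<longlonglongrightarrow> cinner (\<iota> (v y)) k"
proof -
  have "(\<lambda>n. (\<lambda>m. complex_of_real (trunc n y m))) \<longlonglongrightarrow> (\<lambda>m. of_real (y m))"
  proof (rule tendsto_fun_componentwise)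
    fix m
    have "\<forall>\<^sub>F n in sequentially. complex_of_real (trunc n y m) = of_real (y m)"
      using eventually_gt_at_top[of m] by eventually_elim (simp add: trunc_def)
    then show "(\<lambda>n. complex_of_real (trunc n y m)) \<longlonglongrightarrow> of_real (y m)" by (rule tendsto_eventually)
  qed
  then have "(\<lambda>n. u (\<lambda>m. complex_of_real (trunc n y m))) \<longlonglongrightarrow> u (\<lambda>m. of_real (y m))"
    using ext y \<tau> unfolding analytic_extension_def
    by (intro continuous_on_tendsto_compose[of "region \<tau>" u] always_eventually allI Gam_region trunc_in_Gam) auto
  then have "(\<lambda>n. \<iota> (v (trunc n y))) \<longlonglongrightarrow> \<iota> (v y)"
    using ext y trunc_in_Gam[OF y] by (simp add: analytic_extension_def)
  moreover have "bounded_linear (\<lambda>x. cinner x k)"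
    by (rule bounded_linear_intro[of _ "norm k"])
       (simp_all add: cinner_add_left cinner_scaleR_left scaleR_conv_of_real norm_cinner_le)
  ultimately show ?thesis by (rule bounded_linear.tendsto[rotated])
qed

text \<open>The scalar bound holds for pairing with every vector k and is proportional to norm k.
  Choosing k as the embedded error vector at the fixed point y bounds the square of its norm by the
  claimed bound times its norm, and one factor cancels.\<close>

lemma collocation_error:
  fixes \<iota> :: "'h::{real_inner, complete_space} \<Rightarrow> 'k"
  assumes ext: "analytic_extension scaleC \<iota> \<tau> v u" and M: "\<And>z. z \<in> region \<tau> \<Longrightarrow> norm (u z) \<le> M" "M \<ge> 0"
    and \<iota>: "linear \<iota>" "\<And>x. norm (\<iota> x) = norm x"
    and \<tau>: "\<And>m. \<tau> m > 0" and y: "y \<in> Gam"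
    and \<eta>: "\<And>m. \<eta> m > 0"
    and db: "\<And>m p. p > 0 \<Longrightarrow> diff_bound (rho \<tau> m) p \<le> K * (real p + 1)\<^sup>2 * \<eta> m ^ p"
    and ws: "weights_summable \<eta> q K S" and q: "q \<le> 1"
    and A: "finite (index_set \<eta> \<epsilon>)"
  shows "norm (v y - collocation (index_set \<eta> \<epsilon>) v y) \<le> M * (S * \<epsilon> powr (1 - q))"
proof -
  define e where "e = v y - collocation (index_set \<eta> \<epsilon>) v y"
  define L where "L x = cinner (\<iota> x) (\<iota> e)" for x
  have L: "linear L"
    using \<iota>(1) by (intro linearI)
      (simp_all add: L_def linear_add linear_cmul cinner_add_left cinner_scaleR_left scaleR_conv_of_real)
  have "L (collocation (index_set \<eta> \<epsilon>) v y) = collocation (index_set \<eta> \<epsilon>) (\<lambda>y. L (v y)) y"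
    unfolding collocation_def tensor_diff_def linear_sum[OF L]
    using tens_linear[OF L] by (simp add: tens_def)
  then have "L e = L (v y) - collocation (index_set \<eta> \<epsilon>) (\<lambda>y. L (v y)) y"
    unfolding e_def by (simp add: linear_diff[OF L])
  moreover have "norm (L (v y) - collocation (index_set \<eta> \<epsilon>) (\<lambda>y. L (v y)) y) \<le> (M * norm (\<iota> e)) * (S * \<epsilon> powr (1 - q))"
    unfolding L_def
    by (rule collocation_error_scalar[OF scalarised_adm[OF ext M(1) \<tau>] scalarised_limit[OF ext \<tau> y] \<tau> _ y \<eta> db ws q A])
       (use M(2) in auto)
  moreover have "norm (L e) = norm e * norm e"
    by (simp add: L_def cinner_self \<iota>(2) power2_eq_square norm_mult)
  ultimately have "norm e * norm e \<le> (M * (S * \<epsilon> powr (1 - q))) * norm e"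
    by (simp add: \<iota>(2) mult_ac)
  moreover have "S \<ge> 0" using ws unfolding weights_summable_def by (metis empty_iff finite.emptyI sum.empty)
  ultimately show ?thesis unfolding e_def[symmetric] using M(2) by (cases "norm e = 0") auto
qed

end

lemma continuous_on_extension:
  fixes v :: "(nat \<Rightarrow> real) \<Rightarrow> 'h::real_normed_vector" and \<iota> :: "'h \<Rightarrow> 'k::real_normed_vector"
  assumes ext: "analytic_extension sc \<iota> \<tau> v u"
    and \<iota>: "linear \<iota>" "\<And>x. norm (\<iota> x) = norm x" and \<tau>: "\<And>m. \<tau> m > 0"
  shows "continuous_on Gam v"
proof -
  have "continuous_on Gam (\<lambda>y. u (\<lambda>m. complex_of_real (y m)))"
  proof (rule continuous_on_compose2[of "region \<tau>" u])
    show "continuous_on (region \<tau>) u" using ext by (simp add: analytic_extension_def)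
    show "continuous_on Gam (\<lambda>y m. complex_of_real (y m))"
      by (intro continuous_on_coordinatewise_then_product continuous_on_of_real
          continuous_on_subset[OF continuous_on_product_coordinates]) simp
  qed (auto intro: Gam_region \<tau>)
  then have "continuous_on Gam (\<lambda>y. \<iota> (v y))"
    using ext by (subst continuous_on_cong[OF refl, of _ _ "\<lambda>y. u (\<lambda>m. complex_of_real (y m))"])
      (auto simp: analytic_extension_def)
  moreover have "dist (\<iota> a) (\<iota> b) = dist a b" for a b
    by (simp add: dist_norm \<iota>(2) flip: linear_diff[OF \<iota>(1)])
  ultimately show ?thesis by (simp add: continuous_on tendsto_iff)
qed

lemma sup_norm_bound:
  assumes "sup_norm (closed_region \<tau>) u < \<infinity>"
  obtains M where "M \<ge> 0" "\<And>z. z \<in> region \<tau> \<Longrightarrow> norm (u z) \<le> M"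
proof
  let ?s = "sup_norm (closed_region \<tau>) u"
  show "enn2real ?s \<ge> 0" by simp
  fix z assume "z \<in> region \<tau>"
  then have "z \<in> closed_region \<tau>" by (auto simp: region_def closed_region_def less_imp_le)
  then have "ennreal (norm (u z)) \<le> ?s" unfolding sup_norm_def by (rule SUP_upper)
  also have "?s = ennreal (enn2real ?s)" using assms by simp
  finally show "norm (u z) \<le> enn2real ?s" by (simp add: ennreal_le_iff)
qed

section \<open>From the threshold to the number of points\<close>

lemma summable_eta_powr:
  fixes \<eta> :: "nat \<Rightarrow> real"
  assumes \<eta>: "\<And>m. \<eta> m > 0" and lim: "(\<lambda>m. \<eta> m * real (m + 1) powr \<sigma>) \<longlonglongrightarrow> 0"
    and q: "q > 0" "q * \<sigma> > 1"
  shows "summable (\<lambda>m. \<eta> m powr q)"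
proof -
  obtain B where B: "\<And>m. norm (\<eta> m * real (m + 1) powr \<sigma>) \<le> B" "B > 0"
    using convergent_imp_Bseq[OF convergentI[OF lim]] unfolding Bseq_def by blast
  have "summable (\<lambda>m. real m powr - (q * \<sigma>))" using q by (simp add: summable_real_powr_iff)
  then have "summable (\<lambda>m. real (Suc m) powr - (q * \<sigma>))"
    using summable_Suc_iff[of "\<lambda>m. real m powr - (q * \<sigma>)"] by simp
  then have s: "summable (\<lambda>m. B powr q * real (Suc m) powr - (q * \<sigma>))" by (rule summable_mult)
  show ?thesis
  proof (rule summable_comparison_test'[OF s, of 0])
    fix m
    have "\<eta> m = (\<eta> m * real (m + 1) powr \<sigma>) * real (m + 1) powr - \<sigma>"
      by (simp add: mult.assoc flip: powr_add)
    also have "\<dots> \<le> B * real (m + 1) powr - \<sigma>"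
      using B(1)[of m] by (intro mult_right_mono) auto
    finally have "\<eta> m powr q \<le> (B * real (m + 1) powr - \<sigma>) powr q"
      using \<eta>[of m] q by (intro powr_mono2) auto
    also have "\<dots> = B powr q * real (Suc m) powr - (q * \<sigma>)"
      using B(2) by (simp add: powr_mult powr_powr mult.commute)
    finally show "norm (\<eta> m powr q) \<le> B powr q * real (Suc m) powr - (q * \<sigma>)" by simp
  qed
qed

text \<open>Eliminates \<epsilon>. Since 1 - q = q r / 2, the power \<epsilon>^(1-q) is
  (\<epsilon>^(-q))^(-r/2), and the bound on N enters with a nonpositive exponent because r \<ge> 0;
  N \<ge> 1 then allows r to be replaced by s.\<close>

lemma rate_conversion:
  fixes N :: real
  assumes s: "s \<le> r" "r \<ge> 0" and q: "q = 1 / (1 + r / 2)" and S: "S \<ge> 1" and \<epsilon>: "\<epsilon> > 0"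
    and N: "1 \<le> N" "N \<le> S * \<epsilon> powr - q" and M: "M \<ge> 0"
  shows "M * (S * \<epsilon> powr (1 - q)) \<le> (M + 1) * S * S powr (r / 2) * N powr (- s / 2)"
proof -
  have "q * (1 + r / 2) = 1" using s by (simp add: q)
  then have q1: "1 - q = q * r / 2" by (simp add: algebra_simps)
  have "S powr (- r / 2) * \<epsilon> powr (1 - q) = (S * \<epsilon> powr - q) powr (- r / 2)"
    using S \<epsilon> by (simp add: powr_mult powr_powr q1)
  also have "\<dots> \<le> N powr (- r / 2)"
    using N s by (intro powr_mono2') auto
  also have "\<dots> \<le> N powr (- s / 2)"
    using N s by (intro powr_mono) auto
  finally have le: "S powr (- r / 2) * \<epsilon> powr (1 - q) \<le> N powr (- s / 2)" .
  have "S powr (r / 2) * S powr (- r / 2) = 1" using S by (simp flip: powr_add)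
  then have "M * (S * \<epsilon> powr (1 - q)) = M * S * S powr (r / 2) * (S powr (- r / 2) * \<epsilon> powr (1 - q))"
    by (simp add: mult.assoc)
  also have "\<dots> \<le> (M + 1) * S * S powr (r / 2) * N powr (- s / 2)"
    using M S le by (intro mult_mono) auto
  finally show ?thesis .
qed

lemma (in complex_hilbert) collocation_rate:
  fixes \<tau> :: "nat \<Rightarrow> real" and v :: "(nat \<Rightarrow> real) \<Rightarrow> 'h::{real_inner, complete_space}"
    and \<sigma> s :: real and \<iota> :: "'h \<Rightarrow> 'k"
  assumes \<tau>: "\<And>m. \<tau> m > 0" and top: "filterlim \<tau> at_top sequentially"
    and ext: "analytic_extension scaleC \<iota> \<tau> v u" and fin: "sup_norm (closed_region \<tau>) u < \<infinity>"
    and \<iota>: "linear \<iota>" "\<And>x. norm (\<iota> x) = norm x"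
    and \<sigma>: "\<sigma> > 2" "s < \<sigma> - 2"
    and lim: "(\<lambda>m. eta \<tau> m * real (m + 1) powr \<sigma>) \<longlonglongrightarrow> 0"
  shows "\<exists>C>0. \<forall>\<^sub>F \<epsilon> in at_right 0.
           (\<lambda>y. v y - collocation (index_set (eta \<tau>) \<epsilon>) v y) \<in> bochner_L2 unif \<and>
           L2_norm unif (\<lambda>y. v y - collocation (index_set (eta \<tau>) \<epsilon>) v y)
             \<le> C * real (num_points (index_set (eta \<tau>) \<epsilon>)) powr (- s / 2)"
proof -
  \<comment> \<open>A negative s is covered by the rate for exponent 0, since the number of points
    is at least 1; used directly it would not give q in (0,1].\<close>
  define r where "r = max s 0"
  define q where "q = 1 / (1 + r / 2)"
  have r: "s \<le> r" "r \<ge> 0" "1 + r / 2 < \<sigma>" using \<sigma> by (auto simp: r_def max_def)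
  have q: "q > 0" "q \<le> 1" "q * \<sigma> > 1" using r by (auto simp: q_def field_simps)
  note \<eta>0 = eta_0_less_1[of \<tau>, OF \<tau> top] and \<eta>pos = eta_pos[of \<tau>, OF \<tau>]
  define K where "K = 12 / (1 - eta \<tau> 0)"
  have K: "K \<ge> 1" using \<eta>0 \<eta>pos[of 0] by (simp add: K_def field_simps)
  have db: "diff_bound (rho \<tau> m) p \<le> K * (real p + 1)\<^sup>2 * eta \<tau> m ^ p" if "p > 0" for m p
    unfolding K_def by (rule diff_bound_le_eta[of \<tau>, OF \<tau> \<eta>0 that])
  obtain S where S: "S \<ge> 1" "weights_summable (eta \<tau>) q K S"
    using weights_summable_ex[of "eta \<tau>" "eta \<tau> 0" q K, OF \<eta>pos eta_le_eta_0[of \<tau>, OF \<tau>] \<eta>0 q(1)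
        summable_eta_powr[OF \<eta>pos lim q(1,3)]] K by auto
  obtain M where M: "M \<ge> 0" "\<And>z. z \<in> region \<tau> \<Longrightarrow> norm (u z) \<le> M"
    using sup_norm_bound[OF fin] by blast
  have v: "continuous_on Gam v" by (rule continuous_on_extension[OF ext \<iota> \<tau>])
  \<comment> \<open>M + 1 instead of M keeps C positive even if M = 0.\<close>
  define C where "C = (M + 1) * S * S powr (r / 2)"
  have "C > 0" using M S by (simp add: C_def)
  moreover have "(\<lambda>y. v y - collocation (index_set (eta \<tau>) \<epsilon>) v y) \<in> bochner_L2 unif \<and>
           L2_norm unif (\<lambda>y. v y - collocation (index_set (eta \<tau>) \<epsilon>) v y)
             \<le> C * real (num_points (index_set (eta \<tau>) \<epsilon>)) powr (- s / 2)" if \<epsilon>: "0 < \<epsilon>" "\<epsilon> < 1" for \<epsilon>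
  proof -
    let ?A = "index_set (eta \<tau>) \<epsilon>"
    let ?e = "\<lambda>y. v y - collocation ?A v y"
    have A: "finite ?A" by (rule finite_index_set[OF S(2) K q(1) \<epsilon>(1)])
    have "continuous_on Gam ?e"
      by (intro continuous_on_diff v continuous_on_collocation) (auto simp: index_set_def)
    moreover have "norm (?e y) \<le> M * (S * \<epsilon> powr (1 - q))" if "y \<in> Gam" for y
      by (rule collocation_error[OF ext M(2,1) \<iota> \<tau> that \<eta>pos db S(2) q(2) A])
    ultimately have e: "?e \<in> bochner_L2 unif" "L2_norm unif ?e \<le> M * (S * \<epsilon> powr (1 - q))"
      using bochner_L2_continuous by blast+
    note e(2)
    also have "M * (S * \<epsilon> powr (1 - q)) \<le> C * real (num_points ?A) powr (- s / 2)"
      unfolding C_def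
    proof (rule rate_conversion[OF r(1,2) q_def S(1) \<epsilon>(1) _ _ M(1)])
      show "1 \<le> real (num_points ?A)" using num_points_ge_1[OF A] \<epsilon> by simp
      show "real (num_points ?A) \<le> S * \<epsilon> powr - q"
        by (rule num_points_partial[OF S(2) K q(1) \<epsilon>(1) A order_refl])
    qed
    finally show ?thesis using e(1) by blast
  qed
  then have "\<forall>\<^sub>F \<epsilon> in at_right 0.
           (\<lambda>y. v y - collocation (index_set (eta \<tau>) \<epsilon>) v y) \<in> bochner_L2 unif \<and>
           L2_norm unif (\<lambda>y. v y - collocation (index_set (eta \<tau>) \<epsilon>) v y)
             \<le> C * real (num_points (index_set (eta \<tau>) \<epsilon>)) powr (- s / 2)"
    by (intro eventually_at_rightI[of 0 1]) auto
  ultimately show ?thesis by blast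
qed

theorem theorem2:
  fixes \<tau> :: "nat \<Rightarrow> real"
    and v :: "(nat \<Rightarrow> real) \<Rightarrow> 'h::{real_inner, complete_space}"
    and \<sigma> s :: real
  assumes "\<And>m. \<tau> m > 0"
    and "filterlim \<tau> at_top sequentially"
    and "(\<exists>u :: (nat \<Rightarrow> complex) \<Rightarrow> 'h \<times> 'h.
            analytic_extension complexification_scale (\<lambda>x. (x, 0)) \<tau> v u \<and>
            sup_norm (closed_region \<tau>) u < \<infinity>)
         \<or> (\<exists>scaleC cinner. \<exists>u :: (nat \<Rightarrow> complex) \<Rightarrow> 'h.
              complex_hilbert scaleC cinner \<and>
              analytic_extension scaleC (\<lambda>x. x) \<tau> v u \<and>
              sup_norm (closed_region \<tau>) u < \<infinity>)"
    and "\<sigma> > 2 * (1 + ln 4)"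
    and "(\<lambda>m. eta \<tau> m * real (m + 1) powr \<sigma>) \<longlonglongrightarrow> 0"
    and "s < \<sigma> - 2 * (1 + ln 4)"
  shows "\<exists>C>0. \<forall>\<^sub>F \<epsilon> in at_right 0.
           (\<lambda>y. v y - collocation (index_set (eta \<tau>) \<epsilon>) v y) \<in> bochner_L2 unif \<and>
           L2_norm unif (\<lambda>y. v y - collocation (index_set (eta \<tau>) \<epsilon>) v y)
             \<le> C * real (num_points (index_set (eta \<tau>) \<epsilon>)) powr (- s / 2)"
proof -
  define c :: real where "c = ln 4"
  have "c > 0" by (simp add: c_def)
  then have \<sigma>: "\<sigma> > 2" "s < \<sigma> - 2"
    using assms(4,6) unfolding c_def[symmetric] by simp_all
  from assms(3) show ?thesis
  proof (elim disjE exE conjE)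
    fix u :: "(nat \<Rightarrow> complex) \<Rightarrow> 'h \<times> 'h"
    assume u: "analytic_extension complexification_scale (\<lambda>x. (x, 0)) \<tau> v u"
      "sup_norm (closed_region \<tau>) u < \<infinity>"
    have "linear (\<lambda>x :: 'h. (x, 0 :: 'h))" by (rule linearI) simp_all
    then show ?thesis
      by (rule complex_hilbert.collocation_rate[OF complex_hilbert_complexification assms(1,2) u _ _ \<sigma> assms(5)])
         simp
  next
    fix scaleC cinner and u :: "(nat \<Rightarrow> complex) \<Rightarrow> 'h"
    assume "complex_hilbert scaleC cinner"
      and u: "analytic_extension scaleC (\<lambda>x. x) \<tau> v u" "sup_norm (closed_region \<tau>) u < \<infinity>"
    then show ?thesis
      by (intro complex_hilbert.collocation_rate[OF _ assms(1,2) u linear_ident _ \<sigma> assms(5)]) auto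
  qed
qed



end
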